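(* Let $X,Y$ be continua without cut-points, and let $\vec S=(S_1,\dots,S_k)$ and $\vec T=(T_1,\dots,T_l)$ be finite sequences of closed subspaces of $X$ and $Y$ respectively. Then the following are equivalent: (i) there is a homeomorphism $f:X\to Y$ with $f[S_i]=T_i$ for all $i$ (this includes $k=l$); (ii) $J(X,\vec S)$ and $J(Y,\vec T)$ are homeomorphic (for arbitrary choices of the auxiliary sets in their construction).
   Context: A continuum is a connected compact metric space; $x\in X$ is a cut-point if $X\setminus\{x\}$ is disconnected. Construction $I$: for a compact metric space $Z$ and closed $A\subseteq Z$, let $I(Z,A)=(Z\times\{0\})\cup D$ where, if $A\ne\emptyset$, $D\subseteq Z\times(0,1]$ is a nonempty set of points isolated in $D$ with $\overline{D}\setminus D=A\times\{0\}$, and if $A=\emptyset$, $D$ is a singleton in $Z\times(0,1]$; $Z$ is identified with $Z\times\{0\}$. Construction $I_n$: for closed $A_1\subseteq\dots\subseteq A_n\subseteq X$, put $I_0=X$, $I_1(X,A_1)=I(X,A_1)$, and for $k\ge1$, with $D_k=I_k\setminus I_{k-1}$, put $I_{k+1}(X,A_1,\dots,A_{k+1})=I(I_k(X,A_1,\dots,A_k),\overline{D_k}\cup A_{k+1})$ (each $I_{k}$ identified with its copy inside $I_{k+1}$). Boolean coding: for closed $S_1,\dots,S_n\subseteq X$ define an increasing sequence $\vec A(\vec S)$ of length $2^n-1$ recursively: for $n=1$ it is $(S_1)$; if $(B_1,\dots,B_{2^k-1})=\vec A(S_1,\dots,S_k)$, then $\vec A(S_1,\dots,S_{k+1})=(A_1,\dots,A_{2^{k+1}-1})$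 with $A_i=B_i\cap S_{k+1}$ for $1\le i\le 2^k-1$, $A_{2^k}=S_{k+1}$, and $A_i=B_{i-2^k}\cup S_{k+1}$ for $2^k+1\le i\le 2^{k+1}-1$. Set $I(X,\vec S)=I_{2^n-1}(X,\vec A(\vec S))$ and write $I(X,\vec S)=X\cup D$ as a disjoint union. Fan construction: for compact metric $Z$ and closed $B\subseteq Z$, $F(Z,B)$ is the quotient of $(Z\times\{0\})\cup(B\times[0,1])$ by $(x,s)\sim(y,t)\iff(x,s)=(y,t)$ or $s=t=1$. Finally $J(X,\vec S)=F(I(X,\vec S),\overline{D})$.
   Formalization: The case where both X and Y are one-point continua is excluded; there the claim fails, e.g. X=Y={x}, S=({x},∅,{x}), T=(∅,∅,{x}): both J's are the cone over ω^6+1, but no f has f[S_1]=T_1. *)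

theory Defs
  imports "HOL-Analysis.Analysis"
begin

text \<open>Compact metric spaces are represented as compact subsets of a type of class
  \<^class>\<open>metric_space\<close>, with the subspace topology.\<close>

definition continuum :: "'a::metric_space set \<Rightarrow> bool"
  where "continuum X \<longleftrightarrow> compact X \<and> connected X"

definition cut_point :: "'a::metric_space set \<Rightarrow> 'a \<Rightarrow> bool"
  where "cut_point X x \<longleftrightarrow> x \<in> X \<and> \<not> connected (X - {x})"


subsection \<open>The construction I(Z, A)\<close>

text \<open>\<open>aux_set Z A D\<close> says that \<open>D\<close> is an allowed choice of the auxiliary set in the construction
  of I(Z, A).  The space \<open>Z\<close> is compact in all uses, so that the closure of \<open>D\<close> in the ambient type
  is its closure in \<open>Z \<times> {0..1}\<close>.\<close>

definition aux_set :: "'z::metric_space set \<Rightarrow> 'z set \<Rightarrow> ('z \<times> real) set \<Rightarrow> bool"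
  where "aux_set Z A D \<longleftrightarrow>
    D \<subseteq> Z \<times> {0<..1} \<and>
    (if A = {} then is_singleton D
     else D \<noteq> {} \<and> discrete D \<and> closure D - D = A \<times> {0})"

definition I_step :: "'z set \<Rightarrow> ('z \<times> real) set \<Rightarrow> ('z \<times> real) set"
  where "I_step Z D = Z \<times> {0} \<union> D"


subsection \<open>Iterating the construction\<close>

text \<open>All stages live in one type: a point \<open>((x, t\<^sub>1), \<dots>, t\<^sub>k)\<close> of the \<open>k\<close>-th iterate is stored
  as \<open>(x, r)\<close>, where \<open>r :: nat \<Rightarrow> real\<close> has the values \<open>t\<^sub>1, \<dots>, t\<^sub>k\<close> at \<open>0, \<dots>, k - 1\<close> and vanishes
  elsewhere.  With this storage the identification of \<open>Z\<close> with \<open>Z \<times> {0}\<close> becomes an equality, so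
  \<open>I_iter X D k \<subseteq> I_iter X D (Suc k)\<close> and the original space is \<open>X \<times> {\<lambda>_. 0}\<close>.  On functions
  \<open>nat \<Rightarrow> real\<close> the topology is the product topology.  The set \<open>D k\<close> is the auxiliary set used to
  pass from stage \<open>k\<close> to stage \<open>k + 1\<close>.\<close>

definition store :: "nat \<Rightarrow> ('a \<times> (nat \<Rightarrow> real)) \<times> real \<Rightarrow> 'a \<times> (nat \<Rightarrow> real)"
  where "store k = (\<lambda>((x, r), t). (x, r(k := t)))"

primrec I_iter ::
  "'a set \<Rightarrow> (nat \<Rightarrow> (('a \<times> (nat \<Rightarrow> real)) \<times> real) set) \<Rightarrow> nat \<Rightarrow> ('a \<times> (nat \<Rightarrow> real)) set"
  where
    "I_iter X D 0 = X \<times> {\<lambda>_. 0}"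
  | "I_iter X D (Suc k) = store k ` I_step (I_iter X D k) (D k)"

text \<open>The closed subset of stage \<open>k\<close> along which stage \<open>k + 1\<close> is built.  The list \<open>As\<close> is indexed
  from \<open>0\<close>, so \<open>As ! k\<close> is the set written \<open>A\<^sub>k\<^sub>+\<^sub>1\<close> in the mathematical notation.\<close>

definition I_base ::
  "'a::metric_space set \<Rightarrow> 'a set list \<Rightarrow> (nat \<Rightarrow> (('a \<times> (nat \<Rightarrow> real)) \<times> real) set) \<Rightarrow> nat
    \<Rightarrow> ('a \<times> (nat \<Rightarrow> real)) set"
  where "I_base X As D k =
    (if k = 0 then {} else closure (I_iter X D k - I_iter X D (k - 1))) \<union> As ! k \<times> {\<lambda>_. 0}"

definition aux_sets ::
  "'a::metric_space set \<Rightarrow> 'a set list \<Rightarrow> (nat \<Rightarrow> (('a \<times> (nat \<Rightarrow> real)) \<times> real) set) \<Rightarrow> bool"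
  where "aux_sets X As D \<longleftrightarrow>
    (\<forall>k < length As. aux_set (I_iter X D k) (I_base X As D k) (D k))"


subsection \<open>Boolean coding\<close>

text \<open>The recursion starts from the empty list, whose code is empty; its first step gives \<open>[S]\<close> as
  the code of \<open>[S]\<close>.\<close>

definition coding_step :: "'a set list \<Rightarrow> 'a set \<Rightarrow> 'a set list"
  where "coding_step Bs S = map (\<lambda>B. B \<inter> S) Bs @ [S] @ map (\<lambda>B. B \<union> S) Bs"

definition coding :: "'a set list \<Rightarrow> 'a set list"
  where "coding Ss = foldl coding_step [] Ss"

lemma coding_singleton: "coding [S] = [S]"
  by (simp add: coding_def coding_step_def)

lemma coding_snoc: "coding (Ss @ [S]) = coding_step (coding Ss) S"
  by (simp add: coding_def)

lemma length_coding: "length (coding Ss) = 2 ^ length Ss - 1"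
proof (induction Ss rule: rev_induct)
  case Nil
  then show ?case by (simp add: coding_def)
next
  case (snoc S Ss)
  have "(1::nat) \<le> 2 ^ length Ss" by simp
  with snoc show ?case by (simp add: coding_snoc coding_step_def)
qed


subsection \<open>Quotient spaces and the fan construction\<close>

definition quotient_topology :: "'a topology \<Rightarrow> 'a rel \<Rightarrow> 'a set topology"
  where "quotient_topology T r = topology (\<lambda>U. U \<subseteq> topspace T // r \<and> openin T (\<Union>U))"

lemma openin_quotient_topology:
  assumes "equiv (topspace T) r"
  shows "openin (quotient_topology T r) U \<longleftrightarrow> U \<subseteq> topspace T // r \<and> openin T (\<Union>U)"
proof -
  have disj: "c = d" if "c \<in> topspace T // r" "d \<in> topspace T // r" "x \<in> c" "x \<in> d" for c d x
    using quotient_disj[OF assms that(1,2)] that(3,4) by blast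
  have "istopology (\<lambda>U. U \<subseteq> topspace T // r \<and> openin T (\<Union>U))"
    unfolding istopology_def
  proof (intro conjI allI impI)
    fix U V
    assume U: "U \<subseteq> topspace T // r \<and> openin T (\<Union>U)"
      and V: "V \<subseteq> topspace T // r \<and> openin T (\<Union>V)"
    have "\<Union>(U \<inter> V) = \<Union>U \<inter> \<Union>V"
    proof (intro equalityI subsetI)
      fix x assume "x \<in> \<Union>U \<inter> \<Union>V"
      then obtain c d where "c \<in> U" "x \<in> c" "d \<in> V" "x \<in> d" by blast
      moreover from this have "c = d" using U V disj[of c d x] by blast
      ultimately show "x \<in> \<Union>(U \<inter> V)" by blast
    qed blast
    with U V show "U \<inter> V \<subseteq> topspace T // r" "openin T (\<Union>(U \<inter> V))" by auto
  next
    fix K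
    assume K: "\<forall>U\<in>K. U \<subseteq> topspace T // r \<and> openin T (\<Union>U)"
    then show "\<Union>K \<subseteq> topspace T // r" by blast
    have "\<Union>(\<Union>K) = \<Union>((\<Union>) ` K)" by blast
    moreover have "openin T (\<Union>((\<Union>) ` K))" using K by (intro openin_Union) auto
    ultimately show "openin T (\<Union>(\<Union>K))" by simp
  qed
  then show ?thesis by (simp add: quotient_topology_def)
qed

definition fan_domain :: "'z set \<Rightarrow> 'z set \<Rightarrow> ('z \<times> real) set"
  where "fan_domain Z B = Z \<times> {0} \<union> B \<times> {0..1}"

definition fan_rel :: "'z set \<Rightarrow> 'z set \<Rightarrow> ('z \<times> real) rel"
  where "fan_rel Z B =
    {(p, q). p \<in> fan_domain Z B \<and> q \<in> fan_domain Z B \<and> (p = q \<or> snd p = 1 \<and> snd q = 1)}"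

lemma equiv_fan_rel: "equiv (fan_domain Z B) (fan_rel Z B)"
  by (auto intro!: equivI refl_onI symI transI simp: fan_rel_def)

definition fan :: "'z::metric_space set \<Rightarrow> 'z set \<Rightarrow> ('z \<times> real) set topology"
  where "fan Z B = quotient_topology (top_of_set (fan_domain Z B)) (fan_rel Z B)"


subsection \<open>The spaces I(X, S) and J(X, S)\<close>

text \<open>\<open>J_choice X Ss D\<close> says that \<open>D\<close> is an allowed choice of all auxiliary sets in the construction
  of I(X, S), and hence of J(X, S).\<close>

definition J_choice ::
  "'a::metric_space set \<Rightarrow> 'a set list \<Rightarrow> (nat \<Rightarrow> (('a \<times> (nat \<Rightarrow> real)) \<times> real) set) \<Rightarrow> bool"
  where "J_choice X Ss D \<longleftrightarrow> aux_sets X (coding Ss) D"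

definition I_space ::
  "'a set \<Rightarrow> 'a set list \<Rightarrow> (nat \<Rightarrow> (('a \<times> (nat \<Rightarrow> real)) \<times> real) set)
    \<Rightarrow> ('a \<times> (nat \<Rightarrow> real)) set"
  where "I_space X Ss D = I_iter X D (length (coding Ss))"

definition J_space ::
  "'a::metric_space set \<Rightarrow> 'a set list \<Rightarrow> (nat \<Rightarrow> (('a \<times> (nat \<Rightarrow> real)) \<times> real) set)
    \<Rightarrow> (('a \<times> (nat \<Rightarrow> real)) \<times> real) set topology"
  where "J_space X Ss D =
    fan (I_space X Ss D) (closure (I_space X Ss D - X \<times> {\<lambda>_. 0}))"

end

theory Submission
  imports Defs
begin

text \<open>(i) implies (ii): a discrete extension of a compact metric space with prescribed limit set is
  unique up to homeomorphism, in the strong form that a homeomorphism of the base spaces respecting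
  the limit sets extends.  Iterating this over the stages gives \<open>I(X, S) \<cong> I(Y, T)\<close>, and fans over
  homeomorphic pairs are homeomorphic.

  (ii) implies (i): let \<open>P\<close> be the set added in the last stage.  The legs over \<open>P\<close> are the only
  free arcs of \<open>J(X, S)\<close> with a loose end, and these ends are the points with arbitrarily small
  neighbourhoods whose frontier has at most one point; \<open>X\<close> contributes none because it has no
  cut-points.  The legs are dense in the cone over the closure of \<open>D\<close>, so the topology of
  \<open>J(X, S)\<close> determines the cone, its base, and hence the last stage but one together with the set
  along which \<open>P\<close> was attached.  The remaining stages are peeled off by removing isolated points,
  and the Boolean code, hence \<open>S\<close>, is read off from the limit sets of the layers in \<open>X\<close>.  If \<open>X\<close>
  is a point, the recovered set is countable, which separates it from the nondegenerate case.\<close>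

text \<open>The last layer \<open>P\<close> is discarded on both sides rather than recovered. If
  \<open>P\<close> is a single point, the cone over it is an isolated arc, and no topological
  property separates its apex from its base end. Nothing is lost: \<open>P\<close> carries no
  information beyond its limit set, and that set survives in the base without \<open>P\<close>.

  Each layer is attached along the closure of the previous one, so every older point outside
  \<open>X\<close> is a limit of newer ones, and a nondegenerate connected \<open>X\<close> has no
  isolated points of its own. Hence the isolated points of a stage are exactly its newest layer. The
  price is that limit sets inside \<open>X\<close> accumulate: a layer shows only the union of the
  sets prescribed so far. The prescribed sets must therefore increase, which the Boolean code
  achieves for an arbitrary sequence.\<close>

section \<open>Extending homeomorphisms over isolated points\<close>

text \<open>The clause beyond the usual statement records that \<open>p\<close> agrees at every
  point with \<open>g\<close> or with an inverse of \<open>h\<close>. Estimates available for both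
  injections therefore hold for the bijection.\<close>

lemma Schroeder_Bernstein_pieces:
  assumes "inj_on g A" "g ` A \<subseteq> B" "inj_on h B" "h ` B \<subseteq> A"
  obtains p where "bij_betw p A B" "\<And>x. x \<in> A \<Longrightarrow> p x = g x \<or> h (p x) = x"
proof -
  define M where "M = lfp (\<lambda>X. A - h ` (B - g ` X))"
  have M: "M = A - h ` (B - g ` M)"
    unfolding M_def by (rule lfp_unfold) (blast intro: monoI)
  then have MA: "M \<subseteq> A" by blast
  from M have Mc: "A - M = h ` (B - g ` M)" using assms(4) by blast
  define p where "p x = (if x \<in> M then g x else the_inv_into B h x)" for x
  have inv: "the_inv_into B h x \<in> B - g ` M" "h (the_inv_into B h x) = x" if "x \<in> A - M" for x
  proof -
    from that have "x \<in> h ` (B - g ` M)" by (simp only: Mc)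
    then obtain y where y: "y \<in> B - g ` M" "x = h y" by (elim imageE)
    then have "the_inv_into B h x = y" using assms(3) by (simp add: the_inv_into_f_f)
    with y show "the_inv_into B h x \<in> B - g ` M" "h (the_inv_into B h x) = x" by auto
  qed
  have "inj_on p A"
  proof (rule inj_onI)
    fix x y assume xy: "x \<in> A" "y \<in> A" "p x = p y"
    consider "x \<in> M" "y \<in> M" | "x \<in> M" "y \<notin> M" | "x \<notin> M" "y \<in> M" | "x \<notin> M" "y \<notin> M" by blast
    then show "x = y"
    proof cases
      case 1 then show ?thesis using xy assms(1) by (auto simp: p_def inj_on_def)
    next
      case 2
      then have "g x = the_inv_into B h y" using xy by (auto simp: p_def)
      then show ?thesis using 2 xy inv(1)[of y] imageI[of x M g] by (metis DiffD2 DiffI)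
    next
      case 3
      then have "the_inv_into B h x = g y" using xy by (auto simp: p_def)
      then show ?thesis using 3 xy inv(1)[of x] imageI[of y M g] by (metis DiffD2 DiffI)
    next
      case 4
      then have "the_inv_into B h x = the_inv_into B h y" using xy by (auto simp: p_def)
      then show ?thesis using 4 xy inv(2)[of x] inv(2)[of y] by (metis DiffI)
    qed
  qed
  moreover have "p ` A = B"
  proof
    have "p x \<in> B" if "x \<in> A" for x
      using inv(1)[of x] assms(2) that by (cases "x \<in> M") (auto simp: p_def)
    then show "p ` A \<subseteq> B" by blast
    show "B \<subseteq> p ` A"
    proof
      fix y assume y: "y \<in> B"
      show "y \<in> p ` A"
      proof (cases "y \<in> g ` M")
        case True
        then show ?thesis using MA by (auto simp: p_def image_iff)
      next
        case False
        with y have "h y \<in> h ` (B - g ` M)" by blast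
        then have "h y \<notin> M" "h y \<in> A" using Mc by blast+
        moreover have "the_inv_into B h (h y) = y" using y assms(3) by (simp add: the_inv_into_f_f)
        ultimately have "y = p (h y)" by (simp add: p_def)
        with \<open>h y \<in> A\<close> show ?thesis by blast
      qed
    qed
  qed
  ultimately have "bij_betw p A B" by (simp add: bij_betw_def)
  moreover have "p x = g x \<or> h (p x) = x" if "x \<in> A" for x
    using that inv(2)[of x] by (auto simp: p_def)
  ultimately show thesis using that by blast
qed

text \<open>Greedy choice along an enumeration of \<open>A\<close>: at each step only finitely many
  values are taken, while the set on offer is infinite.\<close>

lemma injective_choice_countable:
  fixes F :: "'a \<Rightarrow> 'b set"
  assumes "countable A" "\<And>x. x \<in> A \<Longrightarrow> infinite (F x)"
  obtains c where "inj_on c A" "\<And>x. x \<in> A \<Longrightarrow> c x \<in> F x"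
proof -
  define G where "G n = (if n \<in> to_nat_on A ` A then F (from_nat_into A n) else {})" for n
  have G: "G (to_nat_on A x) = F x" if "x \<in> A" for x
    using that assms(1) by (simp add: G_def)
  have "\<exists>c :: nat \<Rightarrow> 'b. \<forall>n. G n \<noteq> {} \<longrightarrow> c n \<in> G n \<and> c n \<notin> c ` {..<n}"
  proof (rule dependent_wellorder_choice)
    fix r :: 'b and f g :: "nat \<Rightarrow> 'b" and n :: nat
    assume "\<And>m. m < n \<Longrightarrow> f m = g m"
    then have "f ` {..<n} = g ` {..<n}" by auto
    then show "(G n \<noteq> {} \<longrightarrow> r \<in> G n \<and> r \<notin> f ` {..<n}) = (G n \<noteq> {} \<longrightarrow> r \<in> G n \<and> r \<notin> g ` {..<n})"
      by simp
  next
    fix n :: nat and f :: "nat \<Rightarrow> 'b"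
    have "infinite (G n) \<or> G n = {}"
      using assms by (auto simp: G_def)
    then show "\<exists>r. G n \<noteq> {} \<longrightarrow> r \<in> G n \<and> r \<notin> f ` {..<n}"
    proof
      assume "infinite (G n)"
      then have "infinite (G n - f ` {..<n})" by simp
      then have "G n - f ` {..<n} \<noteq> {}" by (metis finite.emptyI)
      then show ?thesis by blast
    qed blast
  qed
  then obtain c where c: "\<And>n. G n \<noteq> {} \<Longrightarrow> c n \<in> G n \<and> c n \<notin> c ` {..<n}" by blast
  define d where "d x = c (to_nat_on A x)" for x
  have ne: "G (to_nat_on A x) \<noteq> {}" if "x \<in> A" for x
    using G[OF that] assms(2)[OF that] by auto
  have "inj_on d A"
  proof (rule inj_onI)
    fix x y assume xy: "x \<in> A" "y \<in> A" "d x = d y"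
    have "\<not> to_nat_on A x < to_nat_on A y" "\<not> to_nat_on A y < to_nat_on A x"
      using c[OF ne[OF xy(1)]] c[OF ne[OF xy(2)]] xy(3) unfolding d_def by (metis imageI lessThan_iff)+
    then have "to_nat_on A x = to_nat_on A y" by simp
    then show "x = y" using xy assms(1) by simp
  qed
  moreover have "d x \<in> F x" if "x \<in> A" for x
    using c[OF ne[OF that]] G[OF that] by (simp add: d_def)
  ultimately show thesis using that by blast
qed

lemma closed_closure_Diff:
  fixes C D :: "'a::metric_space set"
  assumes "closed C" "C \<inter> D = {}" "closure D - D \<subseteq> C"
  shows "closed (closure D - D)"
proof -
  have "closure D - D = closure D \<inter> C" using assms closure_subset by blast
  then show ?thesis using assms(1) by auto
qed

text \<open>An accumulation point of the set would be a limit point of \<open>D\<close> outside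
  \<open>D\<close>, hence in the limit set, while by continuity its distance to the limit set would
  still be at least \<open>e\<close>.\<close>

lemma finite_discrete_away_from_limits:
  fixes C D :: "'a::metric_space set"
  assumes "compact (C \<union> D)" "discrete D" "closure D - D \<noteq> {}" "e > 0"
  shows "finite {d \<in> D. e \<le> infdist d (closure D - D)}"
proof (rule ccontr)
  let ?A = "closure D - D" and ?S = "{d \<in> D. e \<le> infdist d (closure D - D)}"
  assume "infinite ?S"
  then obtain x where x: "x \<in> C \<union> D" "x islimpt ?S"
    using assms(1) unfolding compact_eq_Bolzano_Weierstrass by blast
  have "closed {y. e \<le> infdist y ?A}"
    by (intro closed_Collect_le continuous_intros)
  moreover have "x \<in> closure ?S" using x(2) by (simp add: closure_def)
  ultimately have e: "e \<le> infdist x ?A"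
    using closure_minimal[of ?S "{y. e \<le> infdist y ?A}"] by blast
  have "x islimpt D" using x(2) by (rule islimpt_subset) blast
  then have "x \<notin> D" "x \<in> closure D"
    using assms(2) by (auto simp: discrete_def isolated_in_islimpt_iff closure_def)
  then have "infdist x ?A = 0" by (intro infdist_zero) simp
  with e assms(4) show False by simp
qed

lemma countable_discrete_of_compact:
  fixes C D :: "'a::metric_space set"
  assumes "compact (C \<union> D)" "closed C" "C \<inter> D = {}" "discrete D"
    "closure D - D \<subseteq> C" "closure D - D \<noteq> {}"
  shows "countable D"
proof -
  let ?A = "closure D - D"
  have pos: "0 < infdist d ?A" if "d \<in> D" for d
    using closed_closure_Diff[OF assms(2,3,5)] assms(6) that by (intro infdist_pos_not_in_closed) auto
  have "D \<subseteq> (\<Union>n::nat. {d \<in> D. 1 / Suc n \<le> infdist d ?A})"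
  proof
    fix d assume d: "d \<in> D"
    obtain n :: nat where "1 / Suc n < infdist d ?A"
      using pos[OF d] nat_approx_posE by blast
    with d have "d \<in> {d \<in> D. 1 / Suc n \<le> infdist d ?A}" by simp
    then show "d \<in> (\<Union>n::nat. {d \<in> D. 1 / Suc n \<le> infdist d ?A})" by blast
  qed
  moreover have "finite {d \<in> D. 1 / Suc n \<le> infdist d ?A}" for n
    by (rule finite_discrete_away_from_limits[OF assms(1,4,6)]) simp
  then have "countable (\<Union>n::nat. {d \<in> D. 1 / Suc n \<le> infdist d ?A})"
    by (intro countable_UN) (auto intro: countable_finite)
  ultimately show ?thesis by (rule countable_subset)
qed

text \<open>Continuity is in question only at the limit points of \<open>D\<close>: a point of
  \<open>D\<close> is isolated in the union because \<open>C\<close> is closed, and a point of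
  \<open>C\<close> off the closure of \<open>D\<close> has a neighbourhood free of \<open>D\<close>.
  Compactness makes the continuous bijection a homeomorphism.\<close>

lemma homeomorphism_extend_isolated:
  fixes C D :: "'a::metric_space set" and C' D' :: "'b::metric_space set"
  assumes K: "compact (C \<union> D)" and C: "closed C" "C \<inter> D = {}" and D: "discrete D" "closure D - D \<subseteq> C"
    and hom: "homeomorphism C C' f g" and CD': "C' \<inter> D' = {}"
    and p: "bij_betw p D D'"
    and cont: "\<And>x e. x \<in> closure D - D \<Longrightarrow> e > 0 \<Longrightarrow>
        \<exists>d>0. \<forall>y\<in>D. dist y x < d \<longrightarrow> dist (p y) (f x) < e"
  shows "\<exists>F G. homeomorphism (C \<union> D) (C' \<union> D') F G \<and> (\<forall>x\<in>C. F x = f x)"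
proof -
  define F where "F x = (if x \<in> C then f x else p x)" for x
  have FC: "F x = f x" if "x \<in> C" for x using that by (simp add: F_def)
  have FD: "F x = p x" if "x \<in> D" for x using that C(2) by (auto simp: F_def)
  have "F ` C = C'" using hom FC by (auto simp: homeomorphism_def)
  moreover have "F ` D = D'" using p FD by (auto simp: bij_betw_def)
  ultimately have im: "F ` (C \<union> D) = C' \<union> D'" by blast
  have "inj_on F C"
    using hom FC by (metis (no_types, lifting) homeomorphism_def inj_onI)
  moreover have "inj_on F D" using p FD by (simp add: bij_betw_def inj_on_def)
  ultimately have "inj_on F (C \<union> D)"
    using \<open>F ` C = C'\<close> \<open>F ` D = D'\<close> CD' unfolding inj_on_Un by blast
  moreover have "continuous_on (C \<union> D) F"
    unfolding continuous_on_iff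
  proof (intro ballI allI impI)
    fix x and e :: real
    assume x: "x \<in> C \<union> D" and e: "e > 0"
    show "\<exists>d>0. \<forall>x'\<in>C \<union> D. dist x' x < d \<longrightarrow> dist (F x') (F x) < e"
    proof (cases "x \<in> D")
      case True
      then have "\<not> x islimpt D" using D(1) by (simp add: discrete_def isolated_in_islimpt_iff)
      moreover have "\<not> x islimpt C" using C True closed_limpt by blast
      ultimately have "\<not> x islimpt (C \<union> D)" by (simp add: islimpt_Un)
      then obtain d where "d > 0" "\<forall>x'\<in>C \<union> D. dist x' x < d \<longrightarrow> x' = x"
        unfolding islimpt_approachable by blast
      then show ?thesis using e by (metis dist_self)
    next
      case False
      then have xC: "x \<in> C" using x by blast
      have "continuous_on C f" using hom by (simp add: homeomorphism_def)
      then obtain d1 where d1: "d1 > 0" "\<And>x'. x' \<in> C \<Longrightarrow> dist x' x < d1 \<Longrightarrow> dist (f x') (f x) < e"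
        using xC e unfolding continuous_on_iff by metis
      have "\<exists>d>0. \<forall>y\<in>D. dist y x < d \<longrightarrow> dist (p y) (f x) < e"
      proof (cases "x \<in> closure D")
        case True
        then show ?thesis using cont e False by blast
      next
        case False
        then obtain d where "d > 0" "\<forall>y\<in>D. \<not> dist y x < d"
          unfolding closure_approachable by blast
        then show ?thesis by blast
      qed
      then obtain d2 where d2: "d2 > 0" "\<And>y. y \<in> D \<Longrightarrow> dist y x < d2 \<Longrightarrow> dist (p y) (f x) < e"
        by blast
      show ?thesis
        by (rule exI[of _ "min d1 d2"]) (use d1 d2 FC FD xC in auto)
    qed
  qed
  ultimately obtain G where "homeomorphism (C \<union> D) (C' \<union> D') F G"
    using homeomorphism_compact[OF K] im by blast
  with FC show ?thesis by blast
qed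

text \<open>Every isolated \<open>d\<close> has a nearest limit point \<open>a d\<close>, and
  \<open>c d\<close> is chosen near its image. Tying the error to the distance of \<open>d\<close>
  from the limit set makes it vanish towards the limit set; injectivity is possible because each
  ball around a limit point offers infinitely many candidates.\<close>

lemma close_injection:
  fixes C D :: "'a::metric_space set" and D' :: "'b::metric_space set"
  assumes "compact (C \<union> D)" "closed C" "C \<inter> D = {}" "discrete D"
    "closure D - D \<subseteq> C" "closure D - D \<noteq> {}"
    and f: "f ` (closure D - D) \<subseteq> closure D' - D'"
  obtains a c where "inj_on c D" "c ` D \<subseteq> D'"
    "\<And>d. d \<in> D \<Longrightarrow> a d \<in> closure D - D \<and> dist d (a d) = infdist d (closure D - D)"
    "\<And>d. d \<in> D \<Longrightarrow> dist (c d) (f (a d)) < infdist d (closure D - D)"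
proof -
  let ?A = "closure D - D"
  have clA: "closed ?A" using closed_closure_Diff[OF assms(2,3,5)] .
  moreover have "?A \<inter> (C \<union> D) = ?A" using assms(5) by blast
  ultimately have compA: "compact ?A" using assms(1) closed_Int_compact by metis
  have "\<exists>a\<in>?A. dist d a = infdist d ?A" for d
  proof -
    have "continuous_on ?A (dist d)" by (intro continuous_intros)
    then obtain a where a: "a \<in> ?A" "\<And>y. y \<in> ?A \<Longrightarrow> dist d a \<le> dist d y"
      using continuous_attains_inf[OF compA assms(6)] by metis
    have "infdist d ?A = dist d a"
    proof (rule antisym)
      show "infdist d ?A \<le> dist d a" using a(1) by (rule infdist_le)
      show "dist d a \<le> infdist d ?A"
        unfolding infdist_notempty[OF assms(6)] using assms(6) a(2) by (rule cINF_greatest)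
    qed
    with a(1) show ?thesis by auto
  qed
  then obtain a where a: "\<And>d. a d \<in> ?A \<and> dist d (a d) = infdist d ?A" by metis
  have "infinite (D' \<inter> ball (f (a d)) (infdist d ?A))" if "d \<in> D" for d
  proof -
    have "f (a d) \<in> closure D' - D'" using f a by blast
    then have "f (a d) islimpt D'" by (auto simp: closure_def)
    moreover have "0 < infdist d ?A"
      using clA assms(6) that by (intro infdist_pos_not_in_closed) auto
    ultimately show ?thesis unfolding islimpt_eq_infinite_ball by blast
  qed
  then obtain c where "inj_on c D" "\<And>d. d \<in> D \<Longrightarrow> c d \<in> D' \<inter> ball (f (a d)) (infdist d ?A)"
    using injective_choice_countable[OF countable_discrete_of_compact[OF assms(1-6)],
        of "\<lambda>d. D' \<inter> ball (f (a d)) (infdist d ?A)"] by metis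
  then show thesis using that[of c a] a by (auto simp: dist_commute)
qed

text \<open>Matching each isolated point with a nearby one injectively in both directions, the
  Schroeder--Bernstein construction yields a bijection of the isolated points that moves all but
  finitely many of them by a small amount relative to \<open>f\<close>, which is what continuity needs.\<close>

theorem homeomorphism_extend_discrete:
  fixes C D :: "'a::metric_space set" and C' D' :: "'b::metric_space set"
  assumes K: "compact (C \<union> D)" "closed C" "C \<inter> D = {}" "discrete D" "closure D - D \<subseteq> C"
    and K': "compact (C' \<union> D')" "closed C'" "C' \<inter> D' = {}" "discrete D'" "closure D' - D' \<subseteq> C'"
    and hom: "homeomorphism C C' f g"
    and lim: "f ` (closure D - D) = closure D' - D'"
    and fin: "closure D - D = {} \<Longrightarrow> \<exists>p. bij_betw p D D'"
  shows "\<exists>F G. homeomorphism (C \<union> D) (C' \<union> D') F G \<and> (\<forall>x\<in>C. F x = f x)"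
proof (cases "closure D - D = {}")
  case True
  then obtain p where "bij_betw p D D'" using fin by blast
  then show ?thesis
    using homeomorphism_extend_isolated[OF K hom K'(3)] True by simp
next
  case False
  let ?A = "closure D - D" and ?A' = "closure D' - D'"
  have ne': "?A' \<noteq> {}" using lim False by blast
  have gf: "g (f x) = x" if "x \<in> C" for x using hom that by (simp add: homeomorphism_def)
  have fg: "f (g y) = y" "g y \<in> C" if "y \<in> C'" for y
    using hom that by (auto simp: homeomorphism_def)
  have lim': "g ` ?A' = ?A"
    using lim gf K(5) by (metis (no_types, lifting) image_cong image_ident image_image subsetD)
  obtain a c where c: "inj_on c D" "c ` D \<subseteq> D'"
    and a: "\<And>d. d \<in> D \<Longrightarrow> a d \<in> ?A \<and> dist d (a d) = infdist d ?A"
    and ca: "\<And>d. d \<in> D \<Longrightarrow> dist (c d) (f (a d)) < infdist d ?A"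
    by (rule close_injection[OF K False, of f D']) (use lim in blast)+
  obtain b e where e: "inj_on e D'" "e ` D' \<subseteq> D"
    and b: "\<And>d. d \<in> D' \<Longrightarrow> b d \<in> ?A' \<and> dist d (b d) = infdist d ?A'"
    and eb: "\<And>d. d \<in> D' \<Longrightarrow> dist (e d) (g (b d)) < infdist d ?A'"
    by (rule close_injection[OF K' ne', of g D]) (use lim' in blast)+
  obtain p where p: "bij_betw p D D'" "\<And>d. d \<in> D \<Longrightarrow> p d = c d \<or> e (p d) = d"
    using Schroeder_Bernstein_pieces[OF c e] by blast
  show ?thesis
  proof (rule homeomorphism_extend_isolated[OF K hom K'(3) p(1)])
    fix x and \<epsilon> :: real
    assume x: "x \<in> ?A" and \<epsilon>: "\<epsilon> > 0"
    then have xC: "x \<in> C" using K(5) by blast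
    have "continuous_on C f" using hom by (simp add: homeomorphism_def)
    then obtain d1 where d1: "d1 > 0" "\<And>x'. x' \<in> C \<Longrightarrow> dist x' x < d1 \<Longrightarrow> dist (f x') (f x) < \<epsilon>/2"
      using xC \<epsilon> unfolding continuous_on_iff by (metis half_gt_zero)
    \<comment> \<open>The half of \<open>\<epsilon>\<close> bounds the distance from
      \<open>p y\<close> to the image of a limit point; the half of \<open>d1\<close> puts that
      limit point, which is within twice \<open>\<eta>\<close> of \<open>x\<close>, in the range
      where \<open>f\<close> varies by less than the other half.\<close>
    define \<eta> where "\<eta> = min (\<epsilon>/2) (d1/2)"
    have \<eta>: "\<eta> > 0" "\<eta> \<le> \<epsilon>/2" "\<eta> \<le> d1/2" using \<epsilon> d1 by (auto simp: \<eta>_def)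
    \<comment> \<open>Where \<open>p\<close> inverts \<open>e\<close>, the error is governed by the
      distance of \<open>p y\<close>, not of \<open>y\<close>, from the limit set. Only finitely
      many points of \<open>D'\<close> are far from it, and \<open>d2\<close> keeps \<open>y\<close>
      away from their images under \<open>e\<close>.\<close>
    define S where "S = {y \<in> D'. \<eta> \<le> infdist y ?A'}"
    have "finite (e ` S)"
      unfolding S_def by (intro finite_imageI finite_discrete_away_from_limits[OF K'(1,4) ne'] \<eta>)
    moreover have "x \<notin> e ` S" using e(2) x by (auto simp: S_def)
    ultimately obtain d2 where d2: "d2 > 0" "\<forall>y\<in>e ` S. d2 \<le> dist x y"
      using finite_set_avoid[of "e ` S" x] by metis
    show "\<exists>d>0. \<forall>y\<in>D. dist y x < d \<longrightarrow> dist (p y) (f x) < \<epsilon>"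
    proof (intro exI[of _ "min \<eta> d2"] conjI ballI impI)
      show "min \<eta> d2 > 0" using \<eta> d2 by simp
      fix y assume y: "y \<in> D" and "dist y x < min \<eta> d2"
      then have yx: "dist y x < \<eta>" "dist x y < d2" by (auto simp: dist_commute)
      show "dist (p y) (f x) < \<epsilon>"
      proof (cases "p y = c y")
        case True
        have "infdist y ?A \<le> dist y x" using x by (rule infdist_le)
        moreover have "dist (a y) x \<le> dist y (a y) + dist y x" by (rule dist_triangle3)
        ultimately have "dist (a y) x < d1" using a[OF y] yx \<eta> by linarith
        then have "dist (f (a y)) (f x) < \<epsilon>/2" using d1(2) a[OF y] K(5) by blast
        moreover have "dist (c y) (f (a y)) < \<epsilon>/2"
          using ca[OF y] \<open>infdist y ?A \<le> dist y x\<close> yx \<eta> by linarith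
        ultimately show ?thesis
          using True dist_triangle[of "c y" "f x" "f (a y)"] by simp
      next
        case False
        define z where "z = p y"
        have z: "z \<in> D'" "e z = y" using p y False by (auto simp: z_def bij_betw_def)
        then have "z \<notin> S" using d2 yx by force
        then have iz: "infdist z ?A' < \<eta>" using z by (simp add: S_def)
        have bC: "b z \<in> C'" using b[OF z(1)] K'(5) by blast
        have "dist y (g (b z)) < \<eta>" using eb[OF z(1)] z iz by simp
        moreover have "dist (g (b z)) x \<le> dist y (g (b z)) + dist y x" by (rule dist_triangle3)
        ultimately have "dist (g (b z)) x < d1" using yx \<eta> by linarith
        then have "dist (b z) (f x) < \<epsilon>/2" using d1(2)[of "g (b z)"] fg[OF bC] by simp
        moreover have "dist z (b z) < \<epsilon>/2" using b[OF z(1)] iz \<eta> by simp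
        ultimately show ?thesis
          using dist_triangle[of z "f x" "b z"] by (simp add: z_def)
      qed
    qed
  qed
qed

section \<open>Recovering the base of a fan from its topology\<close>

text \<open>The points of order at most one in the sense of Menger and Urysohn.\<close>

definition end_points :: "'t topology \<Rightarrow> 't set"
  where "end_points T = {p \<in> topspace T. \<forall>W. openin T W \<longrightarrow> p \<in> W \<longrightarrow>
    (\<exists>U c. openin T U \<and> p \<in> U \<and> U \<subseteq> W \<and> T frontier_of U \<subseteq> {c})}"

text \<open>In the fans at hand these points lie on the legs over \<open>P\<close>. Counting the
  ends inside \<open>U\<close> is essential: the complement of a nonisolated point also has a
  one-point frontier, but it contains too many ends.\<close>

definition end_cuts :: "'t topology \<Rightarrow> 't set"
  where "end_cuts T = {p. \<exists>U e. openin T U \<and> U \<inter> end_points T = {e} \<and> T frontier_of U = {p}}"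

text \<open>For a fan this is the base without \<open>P\<close>: the closure of the ends supplies
  the part of the base inside the cone, the complement of the closure of the end cuts supplies the
  points off the cone.\<close>

definition fan_base :: "'t topology \<Rightarrow> 't set"
  where "fan_base T =
    T closure_of end_points T \<union> (topspace T - T closure_of end_cuts T) - end_points T"

definition fan_rim :: "'t topology \<Rightarrow> 't set"
  where "fan_rim T = T closure_of end_points T - end_points T"

lemma end_points_subset: "end_points T \<subseteq> topspace T"
  by (auto simp: end_points_def)

lemma end_cuts_subset: "end_cuts T \<subseteq> topspace T"
  using frontier_of_subset_topspace by (fastforce simp: end_cuts_def)

section \<open>Invariance of ends, end cuts, rim and base under homeomorphisms\<close>

lemma homeomorphic_map_end_points_mem:
  assumes f: "homeomorphic_map T T' f" and p: "p \<in> end_points T"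
  shows "f p \<in> end_points T'"
proof -
  have pT: "p \<in> topspace T" using p by (simp add: end_points_def)
  have "\<exists>U c. openin T' U \<and> f p \<in> U \<and> U \<subseteq> W \<and> T' frontier_of U \<subseteq> {c}"
    if W: "openin T' W" "f p \<in> W" for W
  proof -
    have "openin T {x \<in> topspace T. f x \<in> W}"
      using homeomorphic_imp_continuous_map[OF f] W(1) by (rule openin_continuous_map_preimage)
    moreover have "p \<in> {x \<in> topspace T. f x \<in> W}" using pT W by simp
    ultimately obtain U c where U: "openin T U" "p \<in> U" "U \<subseteq> {x \<in> topspace T. f x \<in> W}"
        "T frontier_of U \<subseteq> {c}"
      using p unfolding end_points_def by blast
    have UT: "U \<subseteq> topspace T" using U(1) by (rule openin_subset)
    have "openin T' (f ` U)" using homeomorphic_map_openness[OF f UT] U(1) by simp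
    moreover have "T' frontier_of (f ` U) \<subseteq> {f c}"
      using homeomorphic_map_frontier_of[OF f UT] U(4) by blast
    ultimately show ?thesis using U(2,3) by blast
  qed
  moreover have "f p \<in> topspace T'" using pT homeomorphic_imp_surjective_map[OF f] by blast
  ultimately show ?thesis unfolding end_points_def by blast
qed

text \<open>For a set defined from the topology alone one inclusion is enough, since the same
  argument applies to the inverse homeomorphism.\<close>

lemma homeomorphic_map_image_eqI:
  assumes "homeomorphic_map T T' f" "A' \<subseteq> topspace T'"
    "\<And>p. p \<in> A \<Longrightarrow> f p \<in> A'" "\<And>g p. homeomorphic_map T' T g \<Longrightarrow> p \<in> A' \<Longrightarrow> g p \<in> A"
  shows "f ` A = A'"
proof -
  obtain g where "homeomorphic_maps T T' f g"
    using assms(1) unfolding homeomorphic_map_maps by (elim exE)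
  then have g: "homeomorphic_map T' T g" "\<And>y. y \<in> topspace T' \<Longrightarrow> f (g y) = y"
    unfolding homeomorphic_maps_map by simp_all
  have "y \<in> f ` A" if y: "y \<in> A'" for y
  proof -
    have "f (g y) = y" using g(2) y assms(2) by blast
    then show ?thesis using assms(4)[OF g(1) y] by (metis imageI)
  qed
  then show ?thesis using assms(3) by blast
qed

lemma homeomorphic_map_end_points:
  assumes "homeomorphic_map T T' f"
  shows "f ` end_points T = end_points T'"
  by (rule homeomorphic_map_image_eqI[OF assms end_points_subset])
    (use assms in \<open>blast intro: homeomorphic_map_end_points_mem\<close>)+

lemma homeomorphic_map_end_cuts_mem:
  assumes f: "homeomorphic_map T T' f" and p: "p \<in> end_cuts T"
  shows "f p \<in> end_cuts T'"
proof -
  obtain U e where U: "openin T U" "U \<inter> end_points T = {e}" "T frontier_of U = {p}"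
    using p unfolding end_cuts_def by blast
  have UT: "U \<subseteq> topspace T" using U(1) by (rule openin_subset)
  have "openin T' (f ` U)" using homeomorphic_map_openness[OF f UT] U(1) by simp
  moreover have "T' frontier_of (f ` U) = {f p}"
    using homeomorphic_map_frontier_of[OF f UT] U(3) by simp
  moreover have "f ` U \<inter> end_points T' = f ` (U \<inter> end_points T)"
    unfolding homeomorphic_map_end_points[OF f, symmetric]
    using inj_on_image_Int[OF homeomorphic_imp_injective_map[OF f] UT end_points_subset] by simp
  ultimately show ?thesis using U(2) unfolding end_cuts_def by force
qed

lemma homeomorphic_map_end_cuts:
  assumes "homeomorphic_map T T' f"
  shows "f ` end_cuts T = end_cuts T'"
  by (rule homeomorphic_map_image_eqI[OF assms end_cuts_subset])
    (use assms in \<open>blast intro: homeomorphic_map_end_cuts_mem\<close>)+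

lemma homeomorphic_map_fan_rim:
  assumes f: "homeomorphic_map T T' f"
  shows "f ` fan_rim T = fan_rim T'"
proof -
  have "f ` fan_rim T = f ` (T closure_of end_points T) - f ` end_points T"
    unfolding fan_rim_def
    by (rule inj_on_image_set_diff[OF homeomorphic_imp_injective_map[OF f]])
      (use closure_of_subset_topspace[of T] end_points_subset[of T] in blast)+
  then show ?thesis
    by (simp add: fan_rim_def homeomorphic_map_closure_of[OF f end_points_subset, symmetric]
        homeomorphic_map_end_points[OF f])
qed

lemma homeomorphic_map_fan_base:
  assumes f: "homeomorphic_map T T' f"
  shows "f ` fan_base T = fan_base T'"
proof -
  note inj = homeomorphic_imp_injective_map[OF f]
  let ?V = "topspace T - T closure_of end_cuts T"
  have "f ` ?V = f ` topspace T - f ` (T closure_of end_cuts T)"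
    by (rule inj_on_image_set_diff[OF inj]) (auto simp: closure_of_subset_topspace in_closure_of)
  then have V: "f ` ?V = topspace T' - T' closure_of end_cuts T'"
    by (simp add: homeomorphic_map_closure_of[OF f end_cuts_subset, symmetric]
        homeomorphic_map_end_cuts[OF f] homeomorphic_imp_surjective_map[OF f])
  have "f ` fan_base T = f ` (T closure_of end_points T \<union> ?V) - f ` end_points T"
    unfolding fan_base_def
    by (rule inj_on_image_set_diff[OF inj])
      (use closure_of_subset_topspace[of T] end_points_subset[of T] in blast)+
  then show ?thesis
    by (simp add: fan_base_def image_Un V homeomorphic_map_closure_of[OF f end_points_subset, symmetric]
        homeomorphic_map_end_points[OF f])
qed

text \<open>A connected set that meets \<open>U\<close> and its complement meets the frontier, and
  an open set is disjoint from its frontier. All such sets therefore share the one point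
  \<open>c\<close>; the later arguments produce two of them that have no common point outside
  \<open>U\<close>.\<close>

lemma frontier_of_connected_cross:
  assumes "openin T U" "T frontier_of U \<subseteq> {c}" "connectedin T L" "L \<inter> U \<noteq> {}" "\<not> L \<subseteq> U"
  shows "c \<in> L - U"
proof -
  have "L \<inter> T frontier_of U \<noteq> {}"
    using assms(3-5) by (intro connectedin_Int_frontier_of) auto
  moreover have "T frontier_of U \<inter> U = {}"
    using frontier_of_openin[OF assms(1)] by blast
  ultimately show ?thesis using assms(2) by blast
qed

text \<open>The fan enters through any quotient map with the right fibres. Points are written
  \<open>q (z, t)\<close> and compared by \<open>q_eq_iff\<close>, without handling equivalence
  classes.\<close>

locale fan_quotient =
  fixes Z B :: "'z::metric_space set" and T :: "'t topology" and q :: "'z \<times> real \<Rightarrow> 't"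
  assumes quot: "quotient_map (top_of_set (fan_domain Z B)) T q"
    and q_eq_iff: "\<And>a b. a \<in> fan_domain Z B \<Longrightarrow> b \<in> fan_domain Z B \<Longrightarrow>
      q a = q b \<longleftrightarrow> a = b \<or> snd a = 1 \<and> snd b = 1"
    and compact_Z: "compact Z" and compact_B: "compact B" and B_subset: "B \<subseteq> Z"
begin

abbreviation "G \<equiv> fan_domain Z B"

lemma mem_G [simp]: "(z, t) \<in> G \<longleftrightarrow> z \<in> Z \<and> t = 0 \<or> z \<in> B \<and> 0 \<le> t \<and> t \<le> 1"
  by (auto simp: fan_domain_def)

lemma topspace_eq: "topspace T = q ` G"
  using quotient_imp_surjective_map[OF quot] by simp

lemma continuous_q: "continuous_map (top_of_set G) T q"
  using quot by (rule quotient_imp_continuous_map)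

lemma q_mem_image: "a \<in> G \<Longrightarrow> A \<subseteq> G \<Longrightarrow> snd a \<noteq> 1 \<Longrightarrow> q a \<in> q ` A \<longleftrightarrow> a \<in> A"
  using q_eq_iff[of a] by (metis image_iff subsetD)

text \<open>The points at height 1 form the only fibre that can be nontrivial, so a set is saturated
  once it contains all or none of them.\<close>

lemma saturated_preimage:
  assumes "\<And>a b. a \<in> G \<inter> W \<Longrightarrow> b \<in> G \<Longrightarrow> snd a = 1 \<Longrightarrow> snd b = 1 \<Longrightarrow> b \<in> W"
  shows "{x \<in> topspace (top_of_set G). q x \<in> q ` (G \<inter> W)} = G \<inter> W"
proof (intro equalityI subsetI)
  fix x assume "x \<in> {x \<in> topspace (top_of_set G). q x \<in> q ` (G \<inter> W)}"
  then obtain y where "x \<in> G" "y \<in> G \<inter> W" "q x = q y" by auto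
  then show "x \<in> G \<inter> W" using q_eq_iff[of x y] assms[of y x] by auto
qed auto

lemma openin_q_image:
  assumes "open W" "\<And>a b. a \<in> G \<inter> W \<Longrightarrow> b \<in> G \<Longrightarrow> snd a = 1 \<Longrightarrow> snd b = 1 \<Longrightarrow> b \<in> W"
  shows "openin T (q ` (G \<inter> W))"
proof -
  have "openin (top_of_set G) (G \<inter> W)" using assms(1) by (rule openin_open_Int)
  then have "openin (top_of_set G) {x \<in> topspace (top_of_set G). q x \<in> q ` (G \<inter> W)}"
    by (subst saturated_preimage[OF assms(2)])
  moreover have "q ` (G \<inter> W) \<subseteq> topspace T" by (auto simp: topspace_eq)
  ultimately show ?thesis using quot unfolding quotient_map_def by blast
qed

lemma closedin_q_image:
  assumes "closed W" "\<And>a b. a \<in> G \<inter> W \<Longrightarrow> b \<in> G \<Longrightarrow> snd a = 1 \<Longrightarrow> snd b = 1 \<Longrightarrow> b \<in> W"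
  shows "closedin T (q ` (G \<inter> W))"
proof -
  have "closedin (top_of_set G) (G \<inter> W)" using assms(1) by (rule closedin_closed_Int)
  then have "closedin (top_of_set G) {x \<in> topspace (top_of_set G). q x \<in> q ` (G \<inter> W)}"
    by (subst saturated_preimage[OF assms(2)])
  moreover have "q ` (G \<inter> W) \<subseteq> topspace T" by (auto simp: topspace_eq)
  ultimately show ?thesis using quot unfolding quotient_map_closedin by blast
qed

lemma openin_preimage:
  assumes "openin T U"
  obtains W where "open W" "{x \<in> G. q x \<in> U} = G \<inter> W"
  using openin_continuous_map_preimage[OF continuous_q assms] by (auto simp: openin_open)

lemma connectedin_q_image: "connected L \<Longrightarrow> L \<subseteq> G \<Longrightarrow> connectedin T (q ` L)"
  by (rule connectedin_continuous_map_image[OF continuous_q]) (simp add: connectedin_subtopology)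

lemma connectedin_leg: "d \<in> B \<Longrightarrow> 0 \<le> a \<Longrightarrow> b \<le> 1 \<Longrightarrow> connectedin T (q ` ({d} \<times> {a..b}))"
  by (rule connectedin_q_image) (auto intro: connected_Times)

lemma leg_cross:
  assumes U: "openin T U" "T frontier_of U \<subseteq> {c}" and d: "d \<in> B" and ab: "0 \<le> a" "b \<le> 1"
    and in_out: "r \<in> {a..b}" "q (d, r) \<in> U" "r' \<in> {a..b}" "q (d, r') \<notin> U"
  obtains t where "t \<in> {a..b}" "c = q (d, t)" "c \<notin> U"
proof -
  have "c \<in> q ` ({d} \<times> {a..b}) - U"
  proof (rule frontier_of_connected_cross[OF U connectedin_leg[OF d ab]])
    have "q (d, r) \<in> q ` ({d} \<times> {a..b})" "q (d, r') \<in> q ` ({d} \<times> {a..b})"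
      using in_out by auto
    then show "q ` ({d} \<times> {a..b}) \<inter> U \<noteq> {}" "\<not> q ` ({d} \<times> {a..b}) \<subseteq> U"
      using in_out by blast+
  qed
  then show thesis using that by auto
qed

lemma q_base_inj: "inj_on (\<lambda>z. q (z, 0)) Z"
  by (rule inj_onI) (simp add: q_eq_iff)

text \<open>Sets at height 0 avoid the apex fibre and are saturated, so the embedding of the base is
  a closed map.\<close>

lemma homeomorphic_map_q_base:
  assumes "closed K" "K \<subseteq> Z"
  shows "homeomorphic_map (top_of_set K) (subtopology T (q ` (K \<times> {0}))) (\<lambda>z. q (z, 0))"
proof (rule bijective_closed_imp_homeomorphic_map)
  have "continuous_map (top_of_set K) (top_of_set G) (\<lambda>z. (z, 0))"
    using assms(2) by (auto intro!: continuous_intros)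
  from continuous_map_compose[OF this continuous_q]
  show "continuous_map (top_of_set K) (subtopology T (q ` (K \<times> {0}))) (\<lambda>z. q (z, 0))"
    by (auto simp: continuous_map_in_subtopology o_def)
  show "closed_map (top_of_set K) (subtopology T (q ` (K \<times> {0}))) (\<lambda>z. q (z, 0))"
    unfolding closed_map_def
  proof (intro allI impI)
    fix C assume "closedin (top_of_set K) C"
    then have C: "closed C" "C \<subseteq> K" using assms(1) closedin_closed_eq by auto
    have "closedin T (q ` (G \<inter> C \<times> {0}))"
      using C by (intro closedin_q_image closed_Times) auto
    moreover have "G \<inter> C \<times> {0} = C \<times> {0}" using C assms by auto
    moreover have "q ` (C \<times> {0}) = (\<lambda>z. q (z, 0)) ` C" by auto
    ultimately have "closedin T ((\<lambda>z. q (z, 0)) ` C)" by simp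
    then show "closedin (subtopology T (q ` (K \<times> {0}))) ((\<lambda>z. q (z, 0)) ` C)"
      using C(2) by (intro closedin_subset_topspace) auto
  qed
  show "(\<lambda>z. q (z, 0)) ` topspace (top_of_set K) = topspace (subtopology T (q ` (K \<times> {0})))"
    using assms(2) by (auto simp: topspace_eq)
  show "inj_on (\<lambda>z. q (z, 0)) (topspace (top_of_set K))"
    using q_base_inj assms(2) by (auto intro: inj_on_subset)
qed

end

text \<open>This level collects what holds without hypotheses on the original continuum. Its bound
  \<open>fan_base_subset\<close> therefore remains available when that continuum is a single
  point.\<close>

locale fan_isolated = fan_quotient +
  fixes P
  assumes isolated: "\<And>d. d \<in> P \<Longrightarrow> d isolated_in Z"
    and closure_P: "closure P = B" and P_ne: "P \<noteq> {}"
begin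

lemma P_subset_B: "P \<subseteq> B"
  using closure_P closure_subset by blast

lemma isolating_nbhd:
  assumes "d \<in> P"
  obtains N where "open N" "N \<inter> Z = {d}"
  using isolated[OF assms] by (auto elim: isolated_inE)

lemma closed_Z_Diff_P: "closed (Z - P)"
proof -
  have "\<exists>N. open N \<and> N \<inter> Z = {d}" if "d \<in> P" for d
    using isolating_nbhd[OF that] by metis
  then obtain N where N: "\<And>d. d \<in> P \<Longrightarrow> open (N d) \<and> N d \<inter> Z = {d}" by metis
  have "x = d" if "x \<in> Z" "d \<in> P" "x \<in> N d" for x d
    using N[OF that(2)] that by blast
  moreover have "d \<in> N d" if "d \<in> P" for d
    using N[OF that] by blast
  ultimately have "Z - P = Z - (\<Union>d\<in>P. N d)" by blast
  then show ?thesis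
    using N compact_imp_closed[OF compact_Z] by (auto intro!: closed_Diff)
qed

lemma openin_leg_part:
  assumes "d \<in> P" "open J" "J \<subseteq> {..<1}"
  shows "openin T (q ` ({d} \<times> (J \<inter> {0..1})))"
proof -
  obtain N where N: "open N" "N \<inter> Z = {d}" using isolating_nbhd[OF assms(1)] .
  have eq: "G \<inter> N \<times> J = {d} \<times> (J \<inter> {0..1})"
    using N assms P_subset_B B_subset by (auto simp: fan_domain_def)
  have "openin T (q ` (G \<inter> N \<times> J))"
    using N assms by (intro openin_q_image open_Times) auto
  then show ?thesis by (simp only: eq)
qed

lemma closedin_leg_part:
  assumes "d \<in> P" "closed J" "J \<subseteq> {..<1}"
  shows "closedin T (q ` ({d} \<times> (J \<inter> {0..1})))"
proof -
  have eq: "G \<inter> {d} \<times> J = {d} \<times> (J \<inter> {0..1})"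
    using assms P_subset_B B_subset by (auto simp: fan_domain_def)
  have "closedin T (q ` (G \<inter> {d} \<times> J))"
    using assms by (intro closedin_q_image closed_Times) auto
  then show ?thesis by (simp only: eq)
qed

lemma leg_initial_segment:
  assumes "d \<in> P" "0 < s" "s < 1"
  shows "openin T (q ` ({d} \<times> {0..<s}))" "T frontier_of (q ` ({d} \<times> {0..<s})) \<subseteq> {q (d, s)}"
proof -
  have "{..<s} \<inter> {0..1} = {0..<s}" "{..s} \<inter> {0..1} = {0..s}" using assms by auto
  then show op: "openin T (q ` ({d} \<times> {0..<s}))"
    using openin_leg_part[OF assms(1), of "{..<s}"] assms by auto
  have "closedin T (q ` ({d} \<times> {0..s}))"
    using closedin_leg_part[OF assms(1), of "{..s}"] assms \<open>{..s} \<inter> {0..1} = {0..s}\<close>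
    by (simp add: subset_iff)
  then have "T closure_of (q ` ({d} \<times> {0..<s})) \<subseteq> q ` ({d} \<times> {0..s})"
    by (intro closure_of_minimal) auto
  moreover have "{0..s} = insert s {0..<s}" using assms by auto
  ultimately show "T frontier_of (q ` ({d} \<times> {0..<s})) \<subseteq> {q (d, s)}"
    unfolding frontier_of_openin[OF op] by auto
qed

text \<open>Since \<open>d\<close> is isolated in the base, half-open initial segments of its leg
  are open. Short ones fit into any neighbourhood, and their only frontier point is the cut on the
  leg.\<close>

lemma isolated_end_point:
  assumes "d \<in> P"
  shows "q (d, 0) \<in> end_points T"
proof -
  have d: "d \<in> B" "d \<in> Z" using assms P_subset_B B_subset by auto
  have "\<exists>U c. openin T U \<and> q (d, 0) \<in> U \<and> U \<subseteq> W \<and> T frontier_of U \<subseteq> {c}"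
    if W: "openin T W" "q (d, 0) \<in> W" for W
  proof -
    obtain V where V: "open V" "{x \<in> G. q x \<in> W} = G \<inter> V" using openin_preimage[OF W(1)] .
    have "(d, 0) \<in> {x \<in> G. q x \<in> W}" using W(2) d by simp
    then have "(d, 0) \<in> G \<inter> V" by (simp only: V(2))
    then obtain A J where AJ: "open A" "open J" "d \<in> A" "0 \<in> J" "A \<times> J \<subseteq> V"
      using open_prod_elim[OF V(1)] by (metis IntD2 mem_Sigma_iff)
    obtain e where e: "e > 0" "ball 0 e \<subseteq> J" by (rule openE[OF AJ(2,4)])
    define s where "s = min (e/2) (1/2)"
    have s: "0 < s" "s < 1" "s < e" using e(1) by (auto simp: s_def)
    have "{0..<s} \<subseteq> ball 0 e" using s by (auto simp: dist_real_def)
    then have "{d} \<times> {0..<s} \<subseteq> G \<inter> V" using e AJ d s by fastforce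
    then have "q ` ({d} \<times> {0..<s}) \<subseteq> W" using V(2) by blast
    then show ?thesis using leg_initial_segment[OF assms s(1,2)] s(1)
      by (intro exI[of _ "q ` ({d} \<times> {0..<s})"] exI[of _ "q (d, s)"]) auto
  qed
  then show ?thesis unfolding end_points_def using d by (auto simp: topspace_eq)
qed

text \<open>The leg leaves a neighbourhood inside the open leg on both sides of height
  \<open>s\<close>. A unique frontier point would lie at height at most \<open>s\<close> and at
  least \<open>s\<close>, so it would be the given point, which is in the open set
  \<open>U\<close>.\<close>

lemma isolated_leg_not_end_point:
  assumes "d \<in> P" "0 < s" "s < 1"
  shows "q (d, s) \<notin> end_points T"
proof
  assume "q (d, s) \<in> end_points T"
  moreover have "{0<..<1} \<inter> {0..1} = {0<..<1::real}" by auto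
  then have "openin T (q ` ({d} \<times> {0<..<1}))"
    using openin_leg_part[OF assms(1), of "{0<..<1}"] by (simp add: subset_iff)
  moreover have "q (d, s) \<in> q ` ({d} \<times> {0<..<1})" using assms by auto
  ultimately obtain U c where U: "openin T U" "q (d, s) \<in> U" "U \<subseteq> q ` ({d} \<times> {0<..<1})"
      "T frontier_of U \<subseteq> {c}"
    unfolding end_points_def by blast
  have dB: "d \<in> B" using assms P_subset_B by auto
  then have dZ: "d \<in> Z" using B_subset by auto
  have out: "q (d, t) \<notin> U" if "t = 0 \<or> t = 1" for t
  proof
    assume "q (d, t) \<in> U"
    then obtain r where "q (d, t) = q (d, r)" "0 < r" "r < 1" using U(3) by auto
    then show False using that q_eq_iff[of "(d, t)" "(d, r)"] dB dZ by auto
  qed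
  obtain r where r: "r \<in> {0..s}" "c = q (d, r)" "c \<notin> U"
    by (rule leg_cross[OF U(1,4) dB, of 0 s s 0]) (use assms U(2) out[of 0] in auto)
  obtain t where t: "t \<in> {s..1}" "c = q (d, t)" "c \<notin> U"
    by (rule leg_cross[OF U(1,4) dB, of s 1 s 1]) (use assms U(2) out[of 1] in auto)
  have rt: "c = q (d, r)" "0 \<le> r" "r \<le> s" "c = q (d, t)" "s \<le> t" "t \<le> 1" "c \<notin> U"
    using r t by auto
  then have "r = t" using q_eq_iff[of "(d, r)" "(d, t)"] dB assms by auto
  then show False using rt U(2) by auto
qed

text \<open>Every neighbourhood of the point meets two legs over \<open>P\<close>, and each of them contributes a
  frontier point.\<close>

lemma limit_leg_not_end_point:
  assumes "z \<in> B - P" "0 \<le> s" "s < 1"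
  shows "q (z, s) \<notin> end_points T"
proof
  assume ep: "q (z, s) \<in> end_points T"
  \<comment> \<open>Halfway between \<open>s\<close> and the apex: below height \<open>s'\<close>
    the legs are still disjoint, and every leg has left \<open>U\<close> when it reaches
    \<open>s'\<close>.\<close>
  define s' where "s' = (s + 1) / 2"
  have s': "s < s'" "s' < 1" "0 < s'" using assms by (auto simp: s'_def)
  have op: "openin T (q ` (G \<inter> UNIV \<times> {..<s'}))"
    using s' by (intro openin_q_image open_Times) auto
  have "q (z, s) \<in> q ` (G \<inter> UNIV \<times> {..<s'})" using assms s' by auto
  with ep op obtain U c where U: "openin T U" "q (z, s) \<in> U" "U \<subseteq> q ` (G \<inter> UNIV \<times> {..<s'})"
      "T frontier_of U \<subseteq> {c}"
    unfolding end_points_def by blast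
  obtain V where V: "open V" "{x \<in> G. q x \<in> U} = G \<inter> V" using openin_preimage[OF U(1)] .
  have "(z, s) \<in> {x \<in> G. q x \<in> U}" using U(2) assms by simp
  then have "(z, s) \<in> G \<inter> V" by (simp only: V(2))
  then obtain A J where AJ: "open A" "open J" "z \<in> A" "s \<in> J" "A \<times> J \<subseteq> V"
    using open_prod_elim[OF V(1)] by (metis IntD2 mem_Sigma_iff)
  have "z islimpt P" using assms closure_P by (auto simp: closure_def)
  then obtain d where d: "d \<in> P" "d \<in> A" using AJ by (meson islimptE)
  \<comment> \<open>Removing \<open>d\<close> from the neighbourhood and using the limit point once
    more yields a second leg.\<close>
  have "z islimpt P" by fact
  moreover have "z \<in> A - {d}" "open (A - {d})" using AJ d assms by auto
  ultimately obtain d' where d': "d' \<in> P" "d' \<in> A - {d}" by (meson islimptE)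
  have cross: "c \<in> q ` ({x} \<times> {s..s'})" if x: "x \<in> P" "x \<in> A" for x
  proof -
    have xB: "x \<in> B" using x P_subset_B by blast
    have "(x, s) \<in> G \<inter> V" using AJ x xB assms by auto
    then have "q (x, s) \<in> U" using V(2) by blast
    moreover have "q (x, s') \<notin> U"
    proof
      assume "q (x, s') \<in> U"
      then have "q (x, s') \<in> q ` (G \<inter> UNIV \<times> {..<s'})" using U(3) by blast
      then show False using xB s' by (subst (asm) q_mem_image) auto
    qed
    ultimately obtain t where "t \<in> {s..s'}" "c = q (x, t)"
      using leg_cross[OF U(1,4) xB, of s s' s s'] assms s' by auto
    then show ?thesis by auto
  qed
  obtain t where t: "c = q (d, t)" "s \<le> t" "t \<le> s'" using cross[OF d] by auto
  obtain t' where t': "c = q (d', t')" "s \<le> t'" "t' \<le> s'" using cross[of d'] d' by auto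
  from t t' show False using q_eq_iff[of "(d, t)" "(d', t')"] d d' P_subset_B assms s' by auto
qed

lemma end_points_subset_base: "end_points T \<subseteq> q ` (Z \<times> {0}) \<union> q ` (B \<times> {1})"
proof
  fix p assume p: "p \<in> end_points T"
  then obtain z t where zt: "p = q (z, t)" "(z, t) \<in> G"
    using end_points_subset[of T] by (auto simp: topspace_eq)
  show "p \<in> q ` (Z \<times> {0}) \<union> q ` (B \<times> {1})"
  proof (cases "t = 0 \<or> t = 1")
    case False
    then have "z \<in> B" "0 < t" "t < 1" using zt(2) by auto
    then have "q (z, t) \<notin> end_points T"
      using isolated_leg_not_end_point[of z t] limit_leg_not_end_point[of z t] by (cases "z \<in> P") auto
    with p zt show ?thesis by simp
  qed (use zt B_subset in auto)
qed

lemma isolated_leg_end_cut: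
  assumes d: "d \<in> P" and s: "0 < s" "s < 1"
  shows "q (d, s) \<in> end_cuts T"
proof -
  let ?U = "q ` ({d} \<times> {0..<s})"
  have dB: "d \<in> B" "d \<in> Z" using d P_subset_B B_subset by auto
  have "?U \<inter> end_points T = {q (d, 0)}"
  proof (intro equalityI subsetI)
    fix x assume "x \<in> ?U \<inter> end_points T"
    then obtain t where "x = q (d, t)" "0 \<le> t" "t < s" "x \<in> end_points T" by auto
    then show "x \<in> {q (d, 0)}"
      using isolated_leg_not_end_point[OF d, of t] s by (cases "t = 0") auto
  qed (use isolated_end_point[OF d] s in auto)
  moreover have "T frontier_of ?U \<noteq> {}"
  proof
    assume "T frontier_of ?U = {}"
    \<comment> \<open>An empty frontier is contained in any singleton. The point
      \<open>q (d, 0)\<close> is chosen because it lies in the open segment, whereas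
      \<open>leg_cross\<close> places the frontier point outside.\<close>
    then have fr: "T frontier_of ?U \<subseteq> {q (d, 0)}" by simp
    have "q (d, 1) \<noteq> q (d, t)" if "0 \<le> t" "t < s" for t
      using q_eq_iff[of "(d, 1)" "(d, t)"] dB s that by auto
    then have out: "q (d, 1) \<notin> ?U" by fastforce
    have inU: "q (d, 0) \<in> ?U" using s by auto
    show False
      by (rule leg_cross[OF leg_initial_segment(1)[OF d s] fr dB(1), of 0 1 0 1])
        (use inU out in simp_all)
  qed
  then have "T frontier_of ?U = {q (d, s)}" using leg_initial_segment(2)[OF d s] by blast
  ultimately show ?thesis unfolding end_cuts_def using leg_initial_segment(1)[OF d s] by blast
qed

lemma closure_of_subset_closure_of:
  assumes "A \<subseteq> G"
  shows "q ` (G \<inter> closure A) \<subseteq> T closure_of (q ` A)"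
proof -
  have "top_of_set G closure_of A = G \<inter> closure A"
    using assms by (simp add: closure_of_subtopology Int_absorb1)
  then show ?thesis
    using continuous_map_image_closure_subset[OF continuous_q, of A] by simp
qed

lemma cone_subset_closure_end_cuts: "q ` (B \<times> {0..1}) \<subseteq> T closure_of end_cuts T"
proof -
  have "q ` (G \<inter> closure (P \<times> {0<..<1})) \<subseteq> T closure_of (q ` (P \<times> {0<..<1}))"
    using P_subset_B by (intro closure_of_subset_closure_of) auto
  also have "closure (P \<times> {0<..<1::real}) = B \<times> {0..1}" by (simp add: closure_Times closure_P)
  also have "G \<inter> B \<times> {0..1} = B \<times> {0..1}" by (auto simp: fan_domain_def)
  also have "T closure_of (q ` (P \<times> {0<..<1})) \<subseteq> T closure_of end_cuts T"
    by (rule closure_of_mono) (auto intro: isolated_leg_end_cut)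
  finally show ?thesis .
qed

lemma fan_base_subset: "fan_base T \<subseteq> q ` (Z \<times> {0}) \<union> q ` (B \<times> {1})"
proof -
  have "G \<inter> (UNIV \<times> {0} \<union> UNIV \<times> {1}) = Z \<times> {0} \<union> B \<times> {1}"
    using B_subset by (auto simp: fan_domain_def)
  moreover have "closedin T (q ` (G \<inter> (UNIV \<times> {0} \<union> UNIV \<times> {1})))"
    by (intro closedin_q_image closed_Un closed_Times) auto
  ultimately have "closedin T (q ` (Z \<times> {0} \<union> B \<times> {1}))" by (simp only:)
  then have "T closure_of end_points T \<subseteq> q ` (Z \<times> {0} \<union> B \<times> {1})"
    using end_points_subset_base by (intro closure_of_minimal) (auto simp: image_Un)
  moreover have "topspace T - T closure_of end_cuts T \<subseteq> q ` (Z \<times> {0})"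
    using cone_subset_closure_end_cuts by (auto simp: topspace_eq fan_domain_def)
  ultimately show ?thesis unfolding fan_base_def by (auto simp: image_Un)
qed

end

text \<open>The condition \<open>no_cut\<close> ranges over all points of the type; for a point
  outside \<open>X\<close> it asserts that \<open>X\<close> itself is connected.\<close>

locale fan_continuum = fan_isolated +
  fixes X
  assumes Z_eq: "Z = X \<union> B" and X_P: "X \<inter> P = {}"
    and no_cut: "\<And>x. connected (X - {x})" and X_inf: "infinite X"
begin

text \<open>If \<open>X\<close> is the whole type, no outside point is available; \<open>X\<close>
  is then the union of two punctured copies that overlap in a third point.\<close>

lemma X_connected: "connected X"
proof (cases "X = UNIV")
  case False
  then obtain x where "x \<notin> X" by blast
  then show ?thesis using no_cut[of x] by simp
next
  case True
  obtain x where x: "x \<in> X" using X_inf by (metis finite.emptyI ex_in_conv)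
  have "infinite (X - {x})" using X_inf by simp
  then obtain y where y: "y \<in> X - {x}" by (metis finite.emptyI ex_in_conv)
  have "infinite (X - {x} - {y})" using X_inf by simp
  then obtain z where z: "z \<in> X - {x} - {y}" by (metis finite.emptyI ex_in_conv)
  note xyz = x y z
  have "connected ((X - {x}) \<union> (X - {y}))"
    by (rule connected_Un[OF no_cut no_cut]) (use xyz in blast)
  moreover have "(X - {x}) \<union> (X - {y}) = X" using xyz by blast
  ultimately show ?thesis by simp
qed

text \<open>Connectedness of \<open>X\<close> forces the frontier point to be some \<open>x'\<close>
  in \<open>X\<close>. As \<open>x'\<close> is not a cut point, \<open>X - {x'}\<close> is connected
  too and still crosses \<open>U\<close>, which gives a second frontier point.\<close>

lemma continuum_not_end_point:
  assumes x: "x \<in> X - B"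
  shows "q (x, 0) \<notin> end_points T"
proof
  assume ep: "q (x, 0) \<in> end_points T"
  have XZ: "X \<subseteq> Z" using Z_eq by blast
  have "infinite (X - {x})" using X_inf by simp
  then obtain y where y: "y \<in> X - {x}" by (metis finite.emptyI ex_in_conv)
  have "infinite (X - {x} - {y})" using X_inf by simp
  then obtain y' where y': "y' \<in> X - {x} - {y}" by (metis finite.emptyI ex_in_conv)
  \<comment> \<open>Two points of \<open>X\<close> are kept outside, because \<open>x'\<close> may
    turn out to be one of them and a witness in \<open>X - {x'}\<close> off \<open>U\<close> is
    still required. Excluding \<open>B\<close> leaves only points of the base in the
    neighbourhood.\<close>
  let ?W = "(- B - {y, y'}) \<times> {..<1::real}"
  have W: "G \<inter> ?W = (X - B - {y, y'}) \<times> {0}"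
    using Z_eq by (auto simp: fan_domain_def)
  have "open (- B - {y, y'})"
    using compact_imp_closed[OF compact_B] by (intro open_Diff open_Compl) auto
  then have "openin T (q ` (G \<inter> ?W))"
    by (intro openin_q_image open_Times) auto
  moreover have "q (x, 0) \<in> q ` (G \<inter> ?W)" unfolding W using x y y' by auto
  ultimately obtain U c where U: "openin T U" "q (x, 0) \<in> U" "U \<subseteq> q ` (G \<inter> ?W)"
      "T frontier_of U \<subseteq> {c}"
    using ep unfolding end_points_def by blast
  have out: "q (u, 0) \<notin> U" if u: "u = y \<or> u = y'" for u
  proof
    assume "q (u, 0) \<in> U"
    then have "q (u, 0) \<in> q ` (G \<inter> ?W)" using U(3) by blast
    then show False using u y y' XZ by (subst (asm) q_mem_image) auto
  qed
  have conn: "connectedin T (q ` ((X - {u}) \<times> {0}))" "connectedin T (q ` (X \<times> {0}))" for u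
    using XZ by (auto intro!: connectedin_q_image connected_Times no_cut X_connected)
  have "c \<in> q ` (X \<times> {0}) - U"
    by (rule frontier_of_connected_cross[OF U(1,4) conn(2)]) (use x y out U(2) in auto)
  then obtain x' where x': "x' \<in> X" "c = q (x', 0)" "c \<notin> U" by auto
  then have "x' \<noteq> x" using U(2) by auto
  have "c \<in> q ` ((X - {x'}) \<times> {0}) - U"
  proof (rule frontier_of_connected_cross[OF U(1,4) conn(1)])
    show "q ` ((X - {x'}) \<times> {0}) \<inter> U \<noteq> {}" using x \<open>x' \<noteq> x\<close> U(2) by auto
    have "y \<in> X - {x'} \<or> y' \<in> X - {x'}" using y y' by auto
    then show "\<not> q ` ((X - {x'}) \<times> {0}) \<subseteq> U" using out by auto
  qed
  then obtain x'' where "x'' \<in> X" "x'' \<noteq> x'" "c = q (x'', 0)" by auto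
  then show False using x' XZ inj_onD[OF q_base_inj, of x' x''] by auto
qed

text \<open>Different legs meet only in the apex, and each leg over \<open>P\<close> leaves a small
  neighbourhood of it through a frontier point of its own, so at most one leg is possible.
  Conversely, if \<open>P\<close> is a singleton then so is its closure \<open>B\<close>, and the
  cone is an arc with the apex as an end.\<close>

lemma apex_end_point_iff:
  assumes b: "b \<in> B"
  shows "q (b, 1) \<in> end_points T \<longleftrightarrow> is_singleton P"
proof
  assume ep: "q (b, 1) \<in> end_points T"
  have "x = y" if xy: "x \<in> P" "y \<in> P" for x y
  proof -
    have "openin T (q ` (G \<inter> UNIV \<times> {1/2<..}))"
      by (intro openin_q_image open_Times) auto
    moreover have "q (b, 1) \<in> q ` (G \<inter> UNIV \<times> {1/2<..})" using b by auto
    ultimately obtain U c where U: "openin T U" "q (b, 1) \<in> U" "U \<subseteq> q ` (G \<inter> UNIV \<times> {1/2<..})"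
        "T frontier_of U \<subseteq> {c}"
      using ep unfolding end_points_def by blast
    have cross: "\<exists>t. c = q (u, t) \<and> 1/2 \<le> t \<and> t < 1" if u: "u \<in> P" for u
    proof -
      have uB: "u \<in> B" using u P_subset_B by blast
      have apex: "q (u, 1) \<in> U" using U(2) q_eq_iff[of "(u, 1)" "(b, 1)"] uB b by auto
      have "q (u, 1/2) \<notin> U"
      proof
        assume "q (u, 1/2) \<in> U"
        then have "q (u, 1/2) \<in> q ` (G \<inter> UNIV \<times> {1/2<..})" using U(3) by blast
        then show False using uB by (subst (asm) q_mem_image) auto
      qed
      then obtain t where "c = q (u, t)" "1/2 \<le> t" "t \<le> 1" "c \<notin> U"
        using leg_cross[OF U(1,4) uB, of "1/2" 1 1 "1/2"] apex by auto
      then show ?thesis using apex by (cases "t = 1") auto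
    qed
    obtain s t where "c = q (x, s)" "1/2 \<le> s" "s < 1" "c = q (y, t)" "1/2 \<le> t" "t < 1"
      using cross[OF xy(1)] cross[OF xy(2)] by blast
    then show "x = y" using q_eq_iff[of "(x, s)" "(y, t)"] xy P_subset_B by auto
  qed
  then show "is_singleton P" using P_ne by (intro is_singletonI') auto
next
  assume "is_singleton P"
  then obtain d where P: "P = {d}" by (auto elim: is_singletonE)
  then have B: "B = {d}" using closure_P by auto
  with b have bd: "b = d" by simp
  have "\<exists>U c. openin T U \<and> q (d, 1) \<in> U \<and> U \<subseteq> W \<and> T frontier_of U \<subseteq> {c}"
    if W: "openin T W" "q (d, 1) \<in> W" for W
  proof -
    obtain V where V: "open V" "{x \<in> G. q x \<in> W} = G \<inter> V" using openin_preimage[OF W(1)] .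
    have "d \<in> B" using B by simp
    then have "(d, 1) \<in> {x \<in> G. q x \<in> W}" using W(2) by simp
    then have "(d, 1) \<in> G \<inter> V" by (simp only: V(2))
    then obtain A J where AJ: "open A" "open J" "d \<in> A" "1 \<in> J" "A \<times> J \<subseteq> V"
      using open_prod_elim[OF V(1)] by (metis IntD2 mem_Sigma_iff)
    obtain e where e: "e > 0" "ball 1 e \<subseteq> J" by (rule openE[OF AJ(2,4)])
    define s where "s = max (1 - e/2) (1/2)"
    have s: "0 < s" "s < 1" "1 - e < s" using e(1) by (auto simp: s_def)
    have eq: "G \<inter> UNIV \<times> {s<..} = {d} \<times> {s<..1}" "G \<inter> UNIV \<times> {s..} = {d} \<times> {s..1}"
      using B s by (auto simp: fan_domain_def)
    have "openin T (q ` (G \<inter> UNIV \<times> {s<..}))" "closedin T (q ` (G \<inter> UNIV \<times> {s..}))"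
      using s by (intro openin_q_image closedin_q_image open_Times closed_Times; auto)+
    then have op: "openin T (q ` ({d} \<times> {s<..1}))" and cl: "closedin T (q ` ({d} \<times> {s..1}))"
      by (simp_all only: eq)
    have "T closure_of (q ` ({d} \<times> {s<..1})) \<subseteq> q ` ({d} \<times> {s..1})"
      by (intro closure_of_minimal cl) auto
    moreover have "{s..1} = insert s {s<..1}" using s by auto
    ultimately have fr: "T frontier_of (q ` ({d} \<times> {s<..1})) \<subseteq> {q (d, s)}"
      unfolding frontier_of_openin[OF op] by auto
    have "{s<..1} \<subseteq> ball 1 e" using s by (auto simp: dist_real_def)
    then have "{d} \<times> {s<..1} \<subseteq> A \<times> J" using e(2) AJ(3) by blast
    moreover have "{d} \<times> {s<..1} \<subseteq> G" using eq(1) by blast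
    ultimately have "{d} \<times> {s<..1} \<subseteq> G \<inter> V" using AJ(5) by blast
    then have "q ` ({d} \<times> {s<..1}) \<subseteq> W" using V(2) by blast
    then show ?thesis using op fr s(2)
      by (intro exI[of _ "q ` ({d} \<times> {s<..1})"] exI[of _ "q (d, s)"]) auto
  qed
  moreover have "(d, 1) \<in> G" using b bd by simp
  ultimately show "q (b, 1) \<in> end_points T"
    unfolding bd end_points_def by (auto simp: topspace_eq)
qed

lemma end_points_cases:
  assumes "p \<in> end_points T"
  obtains d where "d \<in> P" "p = q (d, 0)" | d where "P = {d}" "p = q (d, 1)"
proof -
  from assms obtain z where z: "z \<in> Z" "p = q (z, 0) \<or> z \<in> B \<and> p = q (z, 1)"
    using end_points_subset_base B_subset by blast
  show thesis
  proof (cases "p = q (z, 0)")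
    case True
    have "z \<notin> X - B" using continuum_not_end_point[of z] assms True by blast
    moreover have "z \<notin> B - P" using limit_leg_not_end_point[of z 0] assms True by auto
    ultimately have "z \<in> P" using z(1) Z_eq by blast
    with True that(1) show ?thesis by blast
  next
    case False
    with z have zB: "z \<in> B" "p = q (z, 1)" by auto
    then have "is_singleton P" using apex_end_point_iff assms by blast
    then obtain d where d: "P = {d}" by (auto elim: is_singletonE)
    then have "z = d" using zB closure_P by auto
    with zB d that(2) show ?thesis by blast
  qed
qed

text \<open>If the frontier point is off the legs, every leg that meets \<open>U\<close> lies in
  \<open>U\<close>. The end in \<open>U\<close> is on a leg, so \<open>U\<close> contains the apex,
  hence all legs and all their ends. Having just one end there leaves only one leg, but for a single
  leg the apex is a second end.\<close>

lemma end_cuts_subset_legs: "end_cuts T \<subseteq> q ` (P \<times> {0..1})"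
proof
  fix p assume "p \<in> end_cuts T"
  then obtain U e where U: "openin T U" "U \<inter> end_points T = {e}" "T frontier_of U = {p}"
    unfolding end_cuts_def by blast
  show "p \<in> q ` (P \<times> {0..1})"
  proof (rule ccontr)
    assume p: "p \<notin> q ` (P \<times> {0..1})"
    have leg: "q ` ({d} \<times> {0..1}) \<subseteq> U" if d: "d \<in> P" "q ` ({d} \<times> {0..1}) \<inter> U \<noteq> {}" for d
    proof (rule ccontr)
      assume "\<not> q ` ({d} \<times> {0..1}) \<subseteq> U"
      then have "p \<in> q ` ({d} \<times> {0..1}) - U"
        using d P_subset_B by (intro frontier_of_connected_cross[OF U(1) _ connectedin_leg]) (auto simp: U(3))
      then show False using p d by blast
    qed
    obtain d where d: "d \<in> P" "e = q (d, 0) \<or> e = q (d, 1)"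
      using end_points_cases[of e] U(2) by blast
    have "e \<in> U" using U(2) by blast
    moreover have "e \<in> q ` ({d} \<times> {0..1})" using d(2) by auto
    ultimately have "q ` ({d} \<times> {0..1}) \<subseteq> U" using d(1) by (intro leg) auto
    then have v: "q (d, 1) \<in> U" "q (d, 0) \<in> U" by auto
    have all: "q ` ({d'} \<times> {0..1}) \<subseteq> U" if d': "d' \<in> P" for d'
    proof (rule leg[OF d'])
      have "q (d', 1) = q (d, 1)" using q_eq_iff[of "(d', 1)" "(d, 1)"] d d' P_subset_B by auto
      then show "q ` ({d'} \<times> {0..1}) \<inter> U \<noteq> {}" using v(1) by (auto intro!: image_eqI[of _ q "(d', 1)"])
    qed
    have inU: "q (d', 0) \<in> U \<inter> end_points T" if "d' \<in> P" for d'
      using all[OF that] isolated_end_point[OF that] by auto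
    have "x = y" if "x \<in> P" "y \<in> P" for x y
    proof -
      have "q (x, 0) \<in> {e}" "q (y, 0) \<in> {e}"
        unfolding U(2)[symmetric] using inU that by blast+
      then have "q (x, 0) = q (y, 0)" by simp
      then show "x = y" using that P_subset_B B_subset inj_onD[OF q_base_inj, of x y] by auto
    qed
    then have "is_singleton P" using P_ne by (intro is_singletonI') auto
    then have "q (d, 1) \<in> end_points T" using apex_end_point_iff d P_subset_B by blast
    then have "q (d, 1) \<in> {e}" "q (d, 0) \<in> {e}"
      unfolding U(2)[symmetric] using v inU[OF d(1)] by blast+
    then have "q (d, 1) = q (d, 0)" by simp
    then show False using q_eq_iff[of "(d, 1)" "(d, 0)"] d P_subset_B B_subset by auto
  qed
qed

lemma closure_of_end_cuts: "T closure_of end_cuts T = q ` (B \<times> {0..1})"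
proof
  have "G \<inter> B \<times> UNIV = B \<times> {0..1}" using B_subset by (auto simp: fan_domain_def)
  moreover have "closedin T (q ` (G \<inter> B \<times> UNIV))"
    using compact_imp_closed[OF compact_B] by (intro closedin_q_image closed_Times) (auto simp: fan_domain_def)
  ultimately show "T closure_of end_cuts T \<subseteq> q ` (B \<times> {0..1})"
    using end_cuts_subset_legs P_subset_B by (intro closure_of_minimal) (auto simp: image_iff, blast)
qed (rule cone_subset_closure_end_cuts)

lemma complement_closure_of_end_cuts: "topspace T - T closure_of end_cuts T = q ` ((Z - B) \<times> {0})"
proof -
  have "q (z, 0) \<notin> q ` (B \<times> {0..1})" if "z \<in> Z - B" for z
    using that by (subst q_mem_image) (auto simp: fan_domain_def)
  then show ?thesis
    unfolding closure_of_end_cuts using B_subset by (auto simp: topspace_eq fan_domain_def)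
qed

text \<open>If \<open>P\<close> is a singleton, the apex is an end point as well; removing all end points from
  \<^const>\<open>fan_base\<close> and \<^const>\<open>fan_rim\<close> makes the description uniform.\<close>

lemma fan_rim_eq: "fan_rim T = q ` ((B - P) \<times> {0})"
proof (cases "is_singleton P")
  case False
  have ends: "end_points T = q ` (P \<times> {0})"
  proof (intro equalityI subsetI)
    show "x \<in> q ` (P \<times> {0})" if "x \<in> end_points T" for x
      using that by (rule end_points_cases) (use False in auto)
    show "x \<in> end_points T" if "x \<in> q ` (P \<times> {0})" for x
      using that isolated_end_point by auto
  qed
  have "T closure_of end_points T = q ` (B \<times> {0})"
  proof
    have "G \<inter> B \<times> {0} = B \<times> {0}" using B_subset by (auto simp: fan_domain_def)
    moreover have "closedin T (q ` (G \<inter> B \<times> {0}))"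
      using compact_imp_closed[OF compact_B] by (intro closedin_q_image closed_Times) auto
    ultimately show "T closure_of end_points T \<subseteq> q ` (B \<times> {0})"
      using P_subset_B unfolding ends by (intro closure_of_minimal) auto
    have "q ` (G \<inter> closure (P \<times> {0})) \<subseteq> T closure_of (q ` (P \<times> {0}))"
      using P_subset_B B_subset by (intro closure_of_subset_closure_of) auto
    then show "q ` (B \<times> {0}) \<subseteq> T closure_of end_points T"
      by (simp add: ends closure_Times closure_P \<open>G \<inter> B \<times> {0} = B \<times> {0}\<close>)
  qed
  moreover have "q ` (B \<times> {0}) - q ` (P \<times> {0}) = q ` ((B - P) \<times> {0})"
    using P_subset_B B_subset inj_onD[OF q_base_inj] by blast
  ultimately show ?thesis by (simp add: fan_rim_def ends)
next
  case True
  then obtain d where P: "P = {d}" by (auto elim: is_singletonE)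
  then have B: "B = {d}" using closure_P by auto
  have ends: "end_points T = q ` {(d, 0), (d, 1)}"
  proof (intro equalityI subsetI)
    show "x \<in> q ` {(d, 0), (d, 1)}" if "x \<in> end_points T" for x
      using that by (rule end_points_cases) (use P in auto)
    show "x \<in> end_points T" if "x \<in> q ` {(d, 0), (d, 1)}" for x
      using that isolated_end_point[of d] apex_end_point_iff[of d] True P B by auto
  qed
  \<comment> \<open>Here the set of ends is finite and closed, so the rim is empty, in agreement
    with \<open>B - P = {}\<close>.\<close>
  have "G \<inter> {d} \<times> {0, 1} = {(d, 0), (d, 1)}" using B B_subset by (auto simp: fan_domain_def)
  moreover have "closedin T (q ` (G \<inter> {d} \<times> {0, 1}))"
    by (intro closedin_q_image closed_Times) (auto simp: fan_domain_def B)
  ultimately have "closedin T (end_points T)" by (simp add: ends)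
  then show ?thesis by (simp add: fan_rim_def closure_of_closedin P B)
qed

lemma fan_base_eq: "fan_base T = q ` ((Z - P) \<times> {0})"
proof -
  have "end_points T \<inter> q ` ((Z - B) \<times> {0}) = {}"
  proof -
    have "q (z, 0) \<notin> end_points T" if "z \<in> Z - B" for z
      using continuum_not_end_point[of z] that Z_eq by blast
    then show ?thesis by auto
  qed
  then have "fan_base T = fan_rim T \<union> q ` ((Z - B) \<times> {0})"
    unfolding fan_base_def fan_rim_def complement_closure_of_end_cuts by blast
  also have "\<dots> = q ` ((Z - P) \<times> {0})"
    unfolding fan_rim_eq using P_subset_B B_subset by blast
  finally show ?thesis .
qed

end

section \<open>Fans over homeomorphic pairs\<close>

lemma topspace_quotient_topology:
  assumes "equiv (topspace T) r"
  shows "topspace (quotient_topology T r) = topspace T // r"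
proof
  show "topspace (quotient_topology T r) \<subseteq> topspace T // r"
    using openin_topspace[of "quotient_topology T r"] openin_quotient_topology[OF assms] by blast
  have "openin (quotient_topology T r) (topspace T // r)"
    using openin_quotient_topology[OF assms] Union_quotient[OF assms] by simp
  then show "topspace T // r \<subseteq> topspace (quotient_topology T r)" by (rule openin_subset)
qed

lemma quotient_map_quotient_topology:
  assumes r: "equiv (topspace T) r"
  shows "quotient_map T (quotient_topology T r) (\<lambda>x. r `` {x})"
proof -
  have "{x \<in> topspace T. r `` {x} \<in> U} = \<Union>U" if U: "U \<subseteq> topspace T // r" for U
  proof (intro equalityI subsetI)
    fix x assume "x \<in> {x \<in> topspace T. r `` {x} \<in> U}"
    then show "x \<in> \<Union>U" using equiv_class_self[OF r] by blast
  next
    fix x assume "x \<in> \<Union>U"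
    then obtain c where c: "c \<in> U" "x \<in> c" by blast
    then obtain y where y: "y \<in> topspace T" "c = r `` {y}" using U by (auto elim!: quotientE)
    then have "(y, x) \<in> r" using c by blast
    then have "r `` {x} = c" "x \<in> topspace T"
      using y equiv_class_eq[OF r] equiv_type[OF r] by blast+
    then show "x \<in> {x \<in> topspace T. r `` {x} \<in> U}" using c by simp
  qed
  moreover have "(\<lambda>x. r `` {x}) ` topspace T = topspace T // r"
    by (auto simp: quotient_def)
  ultimately show ?thesis
    unfolding quotient_map_def topspace_quotient_topology[OF r] openin_quotient_topology[OF r] by simp
qed

lemma fan_quotient_fan:
  assumes "compact Z" "compact B" "B \<subseteq> Z"
  shows "fan_quotient Z B (fan Z B) (\<lambda>a. fan_rel Z B `` {a})"
proof
  have eq: "equiv (topspace (top_of_set (fan_domain Z B))) (fan_rel Z B)"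
    using equiv_fan_rel by simp
  show "quotient_map (top_of_set (fan_domain Z B)) (fan Z B) (\<lambda>a. fan_rel Z B `` {a})"
    unfolding fan_def by (rule quotient_map_quotient_topology[OF eq])
  show "fan_rel Z B `` {a} = fan_rel Z B `` {b} \<longleftrightarrow> a = b \<or> snd a = 1 \<and> snd b = 1"
    if "a \<in> fan_domain Z B" "b \<in> fan_domain Z B" for a b
    using eq_equiv_class_iff[OF equiv_fan_rel that] that by (auto simp: fan_rel_def)
qed (use assms in auto)

lemma quotient_map_homeomorphic_space:
  assumes q: "quotient_map S T q" and q': "quotient_map S T' q'"
    and same: "\<And>x y. x \<in> topspace S \<Longrightarrow> y \<in> topspace S \<Longrightarrow> q x = q y \<longleftrightarrow> q' x = q' y"
  shows "T homeomorphic_space T'"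
proof -
  obtain g where g: "continuous_map T T' g" "\<And>x. x \<in> topspace S \<Longrightarrow> g (q x) = q' x"
    using quotient_map_lift_exists[OF q quotient_imp_continuous_map[OF q']] same by metis
  obtain h where h: "continuous_map T' T h" "\<And>x. x \<in> topspace S \<Longrightarrow> h (q' x) = q x"
    using quotient_map_lift_exists[OF q' quotient_imp_continuous_map[OF q]] same by metis
  have "h (g y) = y" if y: "y \<in> topspace T" for y
  proof -
    obtain x where "x \<in> topspace S" "y = q x" using quotient_imp_surjective_map[OF q] y by blast
    then show ?thesis using g h by simp
  qed
  moreover have "g (h y) = y" if y: "y \<in> topspace T'" for y
  proof -
    obtain x where "x \<in> topspace S" "y = q' x" using quotient_imp_surjective_map[OF q'] y by blast
    then show ?thesis using g h by simp
  qed
  ultimately show ?thesis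
    unfolding homeomorphic_space_def homeomorphic_maps_def using g(1) h(1) by blast
qed

lemma homeomorphic_maps_imp_homeomorphism:
  assumes "homeomorphic_maps (top_of_set K) (top_of_set K') f g"
  shows "homeomorphism K K' f g"
proof (rule homeomorphismI)
  show "continuous_on K f" "continuous_on K' g" "f ` K \<subseteq> K'" "g ` K' \<subseteq> K"
    using assms by (simp_all add: homeomorphic_maps_def image_subset_iff_funcset)
qed (use assms in \<open>simp_all add: homeomorphic_maps_def\<close>)

text \<open>Acting on the first coordinate preserves heights and hence the apex fibre. Both fans
  become quotients of the same domain with the same fibres.\<close>

lemma fan_homeomorphic_space:
  assumes Z: "compact Z" "compact B" "B \<subseteq> Z" and hom: "homeomorphism Z Z' f g" and B': "f ` B = B'"
  shows "fan Z B homeomorphic_space fan Z' B'"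
proof -
  have cont: "continuous_on Z f" "continuous_on Z' g" and im: "f ` Z = Z'" "g ` Z' = Z"
    and gf: "\<And>x. x \<in> Z \<Longrightarrow> g (f x) = x" and fg: "\<And>y. y \<in> Z' \<Longrightarrow> f (g y) = y"
    using hom by (auto simp: homeomorphism_def)
  have Z': "compact Z'" "compact B'" "B' \<subseteq> Z'"
    using compact_continuous_image[OF cont(1) Z(1)] im
      compact_continuous_image[OF continuous_on_subset[OF cont(1) Z(3)] Z(2)] B' Z(3) by auto
  interpret fan: fan_quotient Z B "fan Z B" "\<lambda>a. fan_rel Z B `` {a}"
    by (rule fan_quotient_fan[OF Z])
  interpret fan': fan_quotient Z' B' "fan Z' B'" "\<lambda>a. fan_rel Z' B' `` {a}"
    by (rule fan_quotient_fan[OF Z'])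
  define F where "F a = (f (fst a), snd a)" for a :: "'a \<times> real"
  define F' where "F' a = (g (fst a), snd a)" for a :: "'b \<times> real"
  have "g ` f ` B = id ` B" unfolding image_image using gf Z(3) by (intro image_cong) auto
  then have gB: "g ` B' = B" using B' by simp
  have FG: "F a \<in> fan'.G" if "a \<in> fan.G" for a
    using that im B' Z(3) by (auto simp: F_def fan_domain_def)
  have F'G: "F' a \<in> fan.G" if "a \<in> fan'.G" for a
    using that im gB by (auto simp: F'_def fan_domain_def)
  have Gsub: "a \<in> fan.G \<Longrightarrow> fst a \<in> Z" "b \<in> fan'.G \<Longrightarrow> fst b \<in> Z'" for a b
    using Z Z' by (auto simp: fan_domain_def)
  have F'F: "F' (F a) = a" if "a \<in> fan.G" for a
    using that gf Gsub by (auto simp: F_def F'_def)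
  have FF': "F (F' a) = a" if "a \<in> fan'.G" for a
    using that fg Gsub by (auto simp: F_def F'_def)
  have "continuous_on fan.G F"
    unfolding F_def by (intro continuous_intros continuous_on_compose2[OF cont(1)]) (auto dest: Gsub)
  moreover have "continuous_on fan'.G F'"
    unfolding F'_def by (intro continuous_intros continuous_on_compose2[OF cont(2)]) (auto dest: Gsub)
  ultimately have "homeomorphic_maps (top_of_set fan.G) (top_of_set fan'.G) F F'"
    unfolding homeomorphic_maps_def using FG F'G F'F FF' by auto
  then have "homeomorphic_map (top_of_set fan.G) (top_of_set fan'.G) F"
    by (rule homeomorphic_maps_imp_map)
  then have "quotient_map (top_of_set fan.G) (top_of_set fan'.G) F"
    by (simp add: homeomorphic_map_def)
  from quotient_map_compose[OF this fan'.quot]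
  have "quotient_map (top_of_set fan.G) (fan Z' B') (\<lambda>a. fan_rel Z' B' `` {F a})"
    by (simp add: o_def)
  with fan.quot show ?thesis
  proof (rule quotient_map_homeomorphic_space)
    fix x y assume "x \<in> topspace (top_of_set fan.G)" "y \<in> topspace (top_of_set fan.G)"
    then have xy: "x \<in> fan.G" "y \<in> fan.G" by auto
    have "F x = F y \<longleftrightarrow> x = y" using F'F xy by metis
    then show "fan_rel Z B `` {x} = fan_rel Z B `` {y} \<longleftrightarrow> fan_rel Z' B' `` {F x} = fan_rel Z' B' `` {F y}"
      using fan.q_eq_iff[OF xy] fan'.q_eq_iff[OF FG[OF xy(1)] FG[OF xy(2)]] by (simp add: F_def)
  qed
qed

section \<open>Closures and isolated points under homeomorphisms\<close>

lemma homeomorphism_imp_inj_on: "homeomorphism S T f g \<Longrightarrow> inj_on f S"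
  by (rule inj_on_inverseI[of S g]) (simp add: homeomorphism_apply1)

lemma homeomorphism_image_closure:
  fixes f :: "'a::metric_space \<Rightarrow> 'b::metric_space"
  assumes hom: "homeomorphism K K' f g" and K: "compact K" and S: "S \<subseteq> K"
  shows "f ` closure S = closure (f ` S)"
proof
  have f: "continuous_on K f" using hom by (simp add: homeomorphism_def)
  have SK: "closure S \<subseteq> K" using S compact_imp_closed[OF K] by (intro closure_minimal)
  have "closure S = K \<inter> closure S" using SK by blast
  then have "compact (closure S)" using compact_Int_closed[OF K closed_closure[of S]] by simp
  then have "compact (f ` closure S)"
    using continuous_on_subset[OF f SK] by (intro compact_continuous_image)
  then show "closure (f ` S) \<subseteq> f ` closure S"
    by (intro closure_minimal compact_imp_closed image_mono closure_subset)
  show "f ` closure S \<subseteq> closure (f ` S)"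
    by (rule image_closure_subset[OF continuous_on_subset[OF f SK]]) (auto intro: closure_subset[THEN subsetD])
qed

lemma homeomorphism_isolated_in:
  assumes hom: "homeomorphism K K' f g" and x: "x isolated_in K"
  shows "f x isolated_in K'"
proof -
  obtain U where U: "x \<in> K" "open U" "U \<inter> K = {x}" using x by (auto elim: isolated_inE)
  have "continuous_on K' g" using hom by (simp add: homeomorphism_def)
  then obtain V where V: "open V" "V \<inter> K' = g -` U \<inter> K'"
    using U(2) unfolding continuous_on_open_invariant by metis
  have "f x \<in> K'" using hom U(1) by (auto simp: homeomorphism_def)
  moreover have "V \<inter> K' = {f x}"
  proof (intro equalityI subsetI)
    fix y assume "y \<in> V \<inter> K'"
    then have y: "y \<in> K'" "g y \<in> U" using V(2) by blast+
    then have "g y \<in> U \<inter> K" using hom by (auto simp: homeomorphism_def)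
    then have "g y = x" using U(3) by blast
    then show "y \<in> {f x}" using hom y by (auto simp: homeomorphism_def)
  next
    fix y assume "y \<in> {f x}"
    then have "y \<in> g -` U \<inter> K'"
      using U \<open>f x \<in> K'\<close> homeomorphism_apply1[OF hom U(1)] by auto
    then show "y \<in> V \<inter> K'" using V(2) by blast
  qed
  ultimately show ?thesis using V(1) isolated_inI by blast
qed

section \<open>Towers of discrete extensions\<close>

text \<open>Heights and storage are forgotten; what remains are increasing stages, each adding a
  discrete layer with prescribed limit points. The clause \<open>layer_singleton\<close> keeps the
  convention for an empty limit set, which would otherwise leave the finite number of new points
  open.\<close>

locale tower =
  fixes Z :: "nat \<Rightarrow> 'z::metric_space set" and A :: "nat \<Rightarrow> 'z set" and n :: nat
  assumes compact_stage: "k \<le> n \<Longrightarrow> compact (Z k)"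
    and stage_Suc: "k < n \<Longrightarrow> Z k \<subseteq> Z (Suc k)"
    and A_subset: "k < n \<Longrightarrow> A k \<subseteq> Z 0"
    and discrete_layer: "k < n \<Longrightarrow> discrete (Z (Suc k) - Z k)"
    and layer_ne: "k < n \<Longrightarrow> Z (Suc k) - Z k \<noteq> {}"
    and layer_limits: "k < n \<Longrightarrow> closure (Z (Suc k) - Z k) - (Z (Suc k) - Z k) =
      (if k = 0 then {} else closure (Z k - Z (k - 1))) \<union> A k"
    and layer_singleton: "k < n \<Longrightarrow> closure (Z (Suc k) - Z k) - (Z (Suc k) - Z k) = {} \<Longrightarrow>
      is_singleton (Z (Suc k) - Z k)"
begin

abbreviation layer :: "nat \<Rightarrow> 'z set"
  where "layer k \<equiv> Z (Suc k) - Z k"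

definition layer_base :: "nat \<Rightarrow> 'z set"
  where "layer_base k = closure (layer k) - layer k"

lemma layer_base_eq: "k < n \<Longrightarrow> layer_base k = (if k = 0 then {} else closure (layer (k - 1))) \<union> A k"
  using layer_limits[of k] by (cases k) (simp_all add: layer_base_def)

lemma stage_mono: "j \<le> k \<Longrightarrow> k \<le> n \<Longrightarrow> Z j \<subseteq> Z k"
proof (induction rule: dec_induct)
  case (step m)
  then show ?case using stage_Suc[of m] by auto
qed simp

lemma closed_stage: "k \<le> n \<Longrightarrow> closed (Z k)"
  using compact_stage by (simp add: compact_imp_closed)

lemma closure_layer: "k < n \<Longrightarrow> closure (layer k) = layer k \<union> layer_base k"
  using closure_subset[of "layer k"] by (auto simp: layer_base_def)

lemma closure_layer_subset: "k < n \<Longrightarrow> closure (layer k) \<subseteq> Z (Suc k)"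
  by (rule closure_minimal) (auto intro: closed_stage)

lemma layer_base_subset: "k < n \<Longrightarrow> layer_base k \<subseteq> Z k"
  using closure_layer_subset[of "k - 1"] A_subset[of k] stage_mono[of 0 k]
  by (cases k) (auto simp: layer_base_eq)

lemma isolated_layer:
  assumes "k < n" "d \<in> layer k"
  shows "d isolated_in Z (Suc k)"
proof -
  have "\<not> d islimpt layer k"
    using discrete_layer[OF assms(1)] assms(2) by (simp add: discrete_def isolated_in_islimpt_iff)
  moreover have "\<not> d islimpt Z k"
    using closed_stage[of k] assms by (auto simp: closed_limpt)
  moreover have "Z (Suc k) = layer k \<union> Z k" using stage_Suc[OF assms(1)] by blast
  ultimately have "\<not> d islimpt Z (Suc k)" by (metis islimpt_Un)
  then show ?thesis using assms(2) by (simp add: isolated_in_islimpt_iff)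
qed

text \<open>Each layer accumulates at the whole closure of its predecessor.\<close>

lemma closure_layer_mono: "j \<le> k \<Longrightarrow> k < n \<Longrightarrow> closure (layer j) \<subseteq> closure (layer k)"
proof (induction rule: dec_induct)
  case (step m)
  then have "closure (layer m) \<subseteq> layer_base (Suc m)" by (simp add: layer_base_eq)
  then show ?case using step by (auto simp: layer_base_def)
qed simp

lemma stage_Diff_bottom: "k < n \<Longrightarrow> Z (Suc k) - Z 0 \<subseteq> closure (layer k)"
proof (induction k)
  case 0
  then show ?case by (simp add: closure_subset)
next
  case (Suc k)
  have "Z (Suc (Suc k)) - Z 0 \<subseteq> layer (Suc k) \<union> (Z (Suc k) - Z 0)" by blast
  moreover have "Z (Suc k) - Z 0 \<subseteq> closure (layer k)" using Suc by simp
  ultimately show ?case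
    using closure_layer_mono[of k "Suc k"] Suc.prems closure_subset[of "layer (Suc k)"] by auto
qed

text \<open>The fan is built over the closure of everything added to the bottom, while its legs
  stand over the last layer; this identifies the former with the closure of the latter.\<close>

lemma closure_stage_Diff_bottom:
  assumes "k < n"
  shows "closure (Z (Suc k) - Z 0) = closure (layer k)"
proof
  show "closure (Z (Suc k) - Z 0) \<subseteq> closure (layer k)"
    using stage_Diff_bottom[OF assms] by (intro closure_minimal) auto
  show "closure (layer k) \<subseteq> closure (Z (Suc k) - Z 0)"
    using stage_mono[of 0 k] assms by (intro closure_mono) auto
qed

text \<open>Passing to the next layer adds \<open>A (Suc k)\<close> to the trace already present on
  the bottom, which is \<open>A k\<close> by induction. Monotonicity lets the union collapse to the
  new set.\<close>

lemma bottom_Int_layer_base: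
  assumes incr: "\<And>k. Suc k < n \<Longrightarrow> A k \<subseteq> A (Suc k)" and "k < n"
  shows "Z 0 \<inter> layer_base k = A k"
  using assms(2)
proof (induction k)
  case 0
  then show ?case using A_subset[of 0] by (auto simp: layer_base_eq)
next
  case (Suc k)
  have "Z 0 \<inter> closure (layer k) = Z 0 \<inter> layer_base k"
    using closure_layer[of k] stage_mono[of 0 k] Suc.prems by auto
  then show ?case
    using Suc incr[of k] A_subset[of "Suc k"] by (auto simp: layer_base_eq)
qed

text \<open>No older point stays isolated: bottom points are already limits of the bottom, and the
  others lie in the closure of the preceding layer, at which the new layer accumulates.\<close>

lemma isolated_in_stage_Suc:
  assumes perfect: "\<And>x. \<not> x isolated_in Z 0" and "k < n"
  shows "{x. x isolated_in Z (Suc k)} = layer k"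
proof (intro equalityI subsetI)
  fix x assume "x \<in> {x. x isolated_in Z (Suc k)}"
  then have x: "x \<in> Z (Suc k)" "\<not> x islimpt Z (Suc k)" by (auto simp: isolated_in_islimpt_iff)
  have "x \<notin> Z k"
  proof
    assume xk: "x \<in> Z k"
    show False
    proof (cases "x \<in> Z 0")
      case True
      then have "x islimpt Z 0" using perfect[of x] by (simp add: isolated_in_islimpt_iff)
      then show False using x(2) islimpt_subset stage_mono[of 0 "Suc k"] assms(2) by (metis Suc_leI zero_le)
    next
      case False
      then obtain j where k: "k = Suc j" using xk by (cases k) auto
      have "x \<in> closure (layer j)" using stage_Diff_bottom[of j] xk False k assms(2) by auto
      then have "x \<in> closure (layer k) - layer k"
        using layer_base_eq[OF assms(2)] k by (auto simp: layer_base_def)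
      then have "x islimpt layer k" by (auto simp: closure_def)
      then show False using x(2) islimpt_subset by blast
    qed
  qed
  then show "x \<in> layer k" using x by blast
qed (use isolated_layer[OF assms(2)] in auto)

lemma countable_stage:
  assumes "countable (Z 0)" "k \<le> n"
  shows "countable (Z k)"
  using assms(2)
proof (induction k)
  case 0
  then show ?case using assms(1) by simp
next
  case (Suc k)
  then have k: "k < n" by simp
  have Un: "Z k \<union> layer k = Z (Suc k)" using stage_Suc[OF k] by blast
  have "countable (layer k)"
  proof (cases "layer_base k = {}")
    case True
    then obtain d where "layer k = {d}"
      using layer_singleton[OF k] by (auto simp: layer_base_def elim: is_singletonE)
    then show ?thesis by simp
  next
    case False
    then show ?thesis
      using countable_discrete_of_compact[of "Z k" "layer k"] discrete_layer[OF k]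
        layer_base_subset[OF k] closed_stage[of k] compact_stage[of "Suc k"] Un k
      by (simp add: layer_base_def)
  qed
  moreover have "countable (Z k)" using Suc by simp
  ultimately show ?case using Un by (metis countable_Un)
qed

end

text \<open>The images of all lower stages are carried through the induction, because the limit set
  of the next layer involves the closure of a difference of stages, and a homeomorphism of the
  current stage alone need not preserve it.\<close>

lemma tower_extend:
  assumes "tower Z A n" "tower Z' A' n"
    and hom: "homeomorphism (Z 0) (Z' 0) f g" and A: "\<And>k. k < n \<Longrightarrow> f ` A k = A' k"
    and "k \<le> n"
  shows "\<exists>F G. homeomorphism (Z k) (Z' k) F G \<and> (\<forall>x\<in>Z 0. F x = f x) \<and> (\<forall>j\<le>k. F ` Z j = Z' j)"
  using assms(5)
proof (induction k)
  case 0
  have "f ` Z 0 = Z' 0" using hom by (simp add: homeomorphism_def)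
  then show ?case using hom by auto
next
  case (Suc k)
  interpret t: tower Z A n by fact
  interpret t': tower Z' A' n by fact
  have k: "k < n" "k \<le> n" using Suc.prems by auto
  obtain F G where FG: "homeomorphism (Z k) (Z' k) F G" "\<And>x. x \<in> Z 0 \<Longrightarrow> F x = f x"
      "\<And>j. j \<le> k \<Longrightarrow> F ` Z j = Z' j"
    using Suc by auto
  have "F ` A k = f ` A k" using FG(2) t.A_subset[OF k(1)] by (intro image_cong) auto
  then have FA: "F ` A k = A' k" using A[OF k(1)] by simp
  have lim: "F ` t.layer_base k = t'.layer_base k"
  proof (cases k)
    case 0
    then show ?thesis using FA k by (simp add: t.layer_base_eq t'.layer_base_eq)
  next
    case (Suc j)
    have "inj_on F (Z k)" using FG(1) by (rule homeomorphism_imp_inj_on)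
    then have "F ` (Z (Suc j) - Z j) = F ` Z (Suc j) - F ` Z j"
      using Suc t.stage_Suc[of j] k by (intro inj_on_image_set_diff) auto
    then have "F ` t.layer j = t'.layer j" using FG(3)[of j] FG(3)[of k] Suc by simp
    moreover have "F ` closure (t.layer j) = closure (F ` t.layer j)"
      using Suc by (intro homeomorphism_image_closure[OF FG(1) t.compact_stage[OF k(2)]]) auto
    ultimately show ?thesis
      using FA k Suc by (simp add: t.layer_base_eq t'.layer_base_eq image_Un)
  qed
  have Un: "Z k \<union> t.layer k = Z (Suc k)" "Z' k \<union> t'.layer k = Z' (Suc k)"
    using t.stage_Suc[OF k(1)] t'.stage_Suc[OF k(1)] by blast+
  have "\<exists>F' G'. homeomorphism (Z k \<union> t.layer k) (Z' k \<union> t'.layer k) F' G' \<and> (\<forall>x\<in>Z k. F' x = F x)"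
  proof (rule homeomorphism_extend_discrete[OF _ _ _ _ _ _ _ _ _ _ FG(1)])
    show "compact (Z k \<union> t.layer k)" "compact (Z' k \<union> t'.layer k)"
      unfolding Un using Suc.prems by (auto intro: t.compact_stage t'.compact_stage)
    show "closure (t.layer k) - t.layer k \<subseteq> Z k" "closure (t'.layer k) - t'.layer k \<subseteq> Z' k"
      using t.layer_base_subset[OF k(1)] t'.layer_base_subset[OF k(1)]
      by (simp_all add: t.layer_base_def t'.layer_base_def)
    show "F ` (closure (t.layer k) - t.layer k) = closure (t'.layer k) - t'.layer k"
      using lim by (simp add: t.layer_base_def t'.layer_base_def)
    \<comment> \<open>With empty limit sets nothing is left to match topologically; both layers are
      single points.\<close>
    then show "\<exists>p. bij_betw p (t.layer k) (t'.layer k)" if "closure (t.layer k) - t.layer k = {}"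
    proof -
      have "is_singleton (t.layer k)" "is_singleton (t'.layer k)"
        using t.layer_singleton[OF k(1)] t'.layer_singleton[OF k(1)] that
          \<open>F ` (closure (t.layer k) - t.layer k) = closure (t'.layer k) - t'.layer k\<close> by auto
      then obtain d d' where "t.layer k = {d}" "t'.layer k = {d'}" by (auto elim!: is_singletonE)
      then have "bij_betw (\<lambda>_. d') (t.layer k) (t'.layer k)" by (simp add: bij_betw_def)
      then show ?thesis by blast
    qed
  qed (use k t.closed_stage t'.closed_stage t.discrete_layer t'.discrete_layer in auto)
  then obtain F' G' where F': "homeomorphism (Z (Suc k)) (Z' (Suc k)) F' G'"
      "\<And>x. x \<in> Z k \<Longrightarrow> F' x = F x"
    unfolding Un by blast
  have "F' ` Z j = Z' j" if "j \<le> Suc k" for j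
  proof (cases "j = Suc k")
    case True
    then show ?thesis using F'(1) by (simp add: homeomorphism_def)
  next
    case False
    then have "F' ` Z j = F ` Z j"
      using that k t.stage_mono[of j k] F'(2) by (intro image_cong) auto
    then show ?thesis using FG(3)[of j] that False by simp
  qed
  moreover have "F' x = f x" if "x \<in> Z 0" for x
    using that FG(2) F'(2) t.stage_mono[of 0 k] k by auto
  ultimately show ?case using F'(1) by blast
qed

text \<open>Isolatedness is topological, so the homeomorphism matches the newest layers and
  restricts to the stages below. The bottoms have no isolated points, so both towers are exhausted
  simultaneously.\<close>

lemma tower_peel:
  assumes "tower Z A n" "tower Z' A' n'"
    and perfect: "\<And>x. \<not> x isolated_in Z 0" "\<And>x. \<not> x isolated_in Z' 0"
    and "m \<le> n" "m' \<le> n'" "homeomorphism (Z m) (Z' m') f g"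
  shows "m = m' \<and> (\<forall>k\<le>m. f ` Z k = Z' k)"
  using assms(5-)
proof (induction m arbitrary: m')
  case (0)
  interpret t': tower Z' A' n' by fact
  have "m' = 0"
  proof (cases m')
    case (Suc j)
    then obtain d where d: "d \<in> t'.layer j" using t'.layer_ne[of j] 0 by auto
    then have "d isolated_in Z' m'" using t'.isolated_layer[of j d] 0 Suc by simp
    then have "g d isolated_in Z 0"
      using homeomorphism_isolated_in[OF homeomorphism_symD[OF 0(3)]] by blast
    then show ?thesis using perfect by blast
  qed simp
  then show ?case using 0 by (simp add: homeomorphism_def)
next
  case (Suc m)
  interpret t: tower Z A n by fact
  interpret t': tower Z' A' n' by fact
  have m: "m < n" using Suc.prems by simp
  have "m' \<noteq> 0"
  proof
    assume "m' = 0"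
    obtain d where "d \<in> t.layer m" using t.layer_ne[OF m] by auto
    then have "f d isolated_in Z' 0"
      using t.isolated_layer[OF m] homeomorphism_isolated_in[OF Suc.prems(3)] \<open>m' = 0\<close> by blast
    then show False using perfect by blast
  qed
  then obtain j where j: "m' = Suc j" "j < n'" using Suc.prems by (cases m') auto
  have hom: "homeomorphism (Z (Suc m)) (Z' (Suc j)) f g" using Suc.prems j by simp
  have iso: "{x. x isolated_in Z (Suc m)} = t.layer m" "{x. x isolated_in Z' (Suc j)} = t'.layer j"
    using t.isolated_in_stage_Suc[OF perfect(1) m] t'.isolated_in_stage_Suc[OF perfect(2) j(2)] by auto
  have fm: "f x \<in> t'.layer j" if "x \<in> t.layer m" for x
    unfolding iso[symmetric] using homeomorphism_isolated_in[OF hom] that iso by blast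
  have "g y \<in> t.layer m" if "y \<in> t'.layer j" for y
    unfolding iso[symmetric] using homeomorphism_isolated_in[OF homeomorphism_symD[OF hom]] that iso by blast
  moreover have "f (g y) = y" if "y \<in> t'.layer j" for y
    using hom that by (auto simp: homeomorphism_def)
  ultimately have "y \<in> f ` t.layer m" if "y \<in> t'.layer j" for y
    using that by (metis imageI)
  with fm have lay: "f ` t.layer m = t'.layer j" by blast
  have "Z m = Z (Suc m) - t.layer m" "Z' j = Z' (Suc j) - t'.layer j"
    using t.stage_Suc[OF m] t'.stage_Suc[OF j(2)] by blast+
  moreover have "inj_on f (Z (Suc m))" using hom by (rule homeomorphism_imp_inj_on)
  then have "f ` (Z (Suc m) - t.layer m) = f ` Z (Suc m) - f ` t.layer m"
    by (rule inj_on_image_set_diff) auto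
  moreover have "f ` Z (Suc m) = Z' (Suc j)" using hom by (simp add: homeomorphism_def)
  ultimately have im: "f ` Z m = Z' j" using lay by (simp only:)
  then have "homeomorphism (Z m) (Z' j) f g"
    using hom t.stage_Suc[OF m] t'.stage_Suc[OF j(2)] by (intro homeomorphism_of_subsets[OF hom]) auto
  then have "m = j \<and> (\<forall>k\<le>m. f ` Z k = Z' k)" using Suc.IH[of j] m j by auto
  then show ?case using \<open>f ` Z (Suc m) = Z' (Suc j)\<close> j by (auto simp: le_Suc_eq)
qed

text \<open>The towers have one layer more than the stages known to be homeomorphic. That layer is
  represented only by its limit set, so \<open>lim\<close> settles \<open>k = n\<close>; for smaller
  \<open>k\<close> the limit set is computed inside stage \<open>n\<close>. Its trace on the bottom
  is \<open>A k\<close>.\<close>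

lemma tower_recover:
  assumes T: "tower Z A (Suc n)" and T': "tower Z' A' (Suc n')"
    and perfect: "\<And>x. \<not> x isolated_in Z 0" "\<And>x. \<not> x isolated_in Z' 0"
    and incr: "\<And>k. k < n \<Longrightarrow> A k \<subseteq> A (Suc k)" "\<And>k. k < n' \<Longrightarrow> A' k \<subseteq> A' (Suc k)"
    and hom: "homeomorphism (Z n) (Z' n') f g"
    and lim: "f ` tower.layer_base Z n = tower.layer_base Z' n'"
  shows "n = n' \<and> f ` Z 0 = Z' 0 \<and> (\<forall>k\<le>n. f ` A k = A' k)"
proof -
  interpret t: tower Z A "Suc n" by fact
  interpret t': tower Z' A' "Suc n'" by fact
  have peel: "n = n'" "\<And>k. k \<le> n \<Longrightarrow> f ` Z k = Z' k"
    using tower_peel[OF T T' perfect _ _ hom] by auto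
  have inj: "inj_on f (Z n)" using hom by (rule homeomorphism_imp_inj_on)
  have "f ` A k = A' k" if k: "k \<le> n" for k
  proof -
    have "f ` t.layer_base k = t'.layer_base k"
    proof (cases "k = n")
      case False
      then have kn: "k < n" using k by simp
      have sub: "t.layer k \<subseteq> Z n" using t.stage_mono[of "Suc k" n] kn by auto
      have "f ` t.layer k = f ` Z (Suc k) - f ` Z k"
        using t.stage_mono[of "Suc k" n] t.stage_mono[of k n] kn
        by (intro inj_on_image_set_diff[OF inj]) auto
      then have lay: "f ` t.layer k = t'.layer k" using peel kn by simp
      have "f ` closure (t.layer k) = closure (f ` t.layer k)"
        using sub by (intro homeomorphism_image_closure[OF hom t.compact_stage]) auto
      moreover have "f ` (closure (t.layer k) - t.layer k) = f ` closure (t.layer k) - f ` t.layer k"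
      proof (rule inj_on_image_set_diff[OF inj])
        have "closure (t.layer k) \<subseteq> Z n" using sub t.closed_stage[of n] by (intro closure_minimal) auto
        then show "closure (t.layer k) - t.layer k \<subseteq> Z n" by blast
      qed (rule sub)
      ultimately show ?thesis by (simp add: t.layer_base_def t'.layer_base_def lay)
    qed (use lim peel(1) in simp)
    moreover have "f ` (Z 0 \<inter> t.layer_base k) = f ` Z 0 \<inter> f ` t.layer_base k"
      using t.stage_mono[of 0 n] t.stage_mono[of k n] t.layer_base_subset[of k] k
      by (intro inj_on_image_Int[OF inj]) auto
    moreover have "Z 0 \<inter> t.layer_base k = A k" "Z' 0 \<inter> t'.layer_base k = A' k"
      using t.bottom_Int_layer_base[of k] t'.bottom_Int_layer_base[of k] incr k peel(1) by auto
    ultimately show ?thesis using peel(2)[of 0] by simp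
  qed
  then show ?thesis using peel by simp
qed

section \<open>The stages of the construction\<close>

text \<open>A singleton is discrete and closed, so the description of the limit set also covers
  empty \<open>A\<close>; the last conclusion alone refers to the case distinction.\<close>

lemma aux_setD:
  assumes "aux_set Z A D"
  shows "D \<subseteq> Z \<times> {0<..1}" "D \<noteq> {}" "discrete D" "closure D - D = A \<times> {0}"
    "A = {} \<Longrightarrow> is_singleton D"
proof -
  show "D \<subseteq> Z \<times> {0<..1}" using assms by (simp add: aux_set_def)
  show "A = {} \<Longrightarrow> is_singleton D" using assms by (simp add: aux_set_def)
  show "D \<noteq> {}" using assms by (auto simp: aux_set_def is_singleton_def split: if_splits)
  show "discrete D"
  proof (cases "A = {}")
    case True
    then obtain d where "D = {d}" using assms by (auto simp: aux_set_def elim: is_singletonE)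
    then show ?thesis by (auto simp: discrete_def isolated_in_def)
  qed (use assms in \<open>simp add: aux_set_def\<close>)
  show "closure D - D = A \<times> {0}"
  proof (cases "A = {}")
    case True
    then obtain d where "D = {d}" using assms by (auto simp: aux_set_def elim: is_singletonE)
    then show ?thesis using True by simp
  qed (use assms in \<open>simp add: aux_set_def\<close>)
qed

section \<open>The storage map and its continuous inverse\<close>

lemma continuous_store: "continuous_on S (store k)"
proof -
  have "continuous_on S (\<lambda>p :: ('a \<times> (nat \<Rightarrow> real)) \<times> real. ((snd (fst p))(k := snd p)) i)" for i
  proof (cases "i = k")
    case False
    have "continuous_on S (\<lambda>p :: ('a \<times> (nat \<Rightarrow> real)) \<times> real. snd (fst p) i)"
      by (rule continuous_on_product_then_coordinatewise[OF continuous_on_snd[OF continuous_on_fst[OF continuous_on_id]]])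
    then show ?thesis using False by simp
  qed (simp add: continuous_on_snd)
  then have "continuous_on S (\<lambda>p :: ('a \<times> (nat \<Rightarrow> real)) \<times> real. (snd (fst p))(k := snd p))"
    by (rule continuous_on_coordinatewise_then_product)
  then have "continuous_on S (\<lambda>p :: ('a \<times> (nat \<Rightarrow> real)) \<times> real. (fst (fst p), (snd (fst p))(k := snd p)))"
    by (intro continuous_on_Pair continuous_on_fst continuous_on_id)
  moreover have "store k = (\<lambda>p :: ('a \<times> (nat \<Rightarrow> real)) \<times> real. (fst (fst p), (snd (fst p))(k := snd p)))"
    by (auto simp: store_def)
  ultimately show ?thesis by simp
qed

text \<open>Splits coordinate \<open>k\<close> off again and resets it to 0. Being continuous and
  inverse to \<open>store k\<close> where that coordinate was 0, it carries discreteness over to the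
  stored layers.\<close>

definition unstore :: "nat \<Rightarrow> 'a \<times> (nat \<Rightarrow> real) \<Rightarrow> ('a \<times> (nat \<Rightarrow> real)) \<times> real"
  where "unstore k = (\<lambda>p. ((fst p, (snd p)(k := 0)), snd p k))"

lemma continuous_unstore: "continuous_on S (unstore k)"
proof -
  have coord: "continuous_on S (\<lambda>p :: 'a \<times> (nat \<Rightarrow> real). snd p i)" for i
    by (rule continuous_on_product_then_coordinatewise[OF continuous_on_snd[OF continuous_on_id]])
  have "continuous_on S (\<lambda>p :: 'a \<times> (nat \<Rightarrow> real). ((snd p)(k := 0)) i)" for i
    using coord[of i] by (cases "i = k") auto
  then have "continuous_on S (\<lambda>p :: 'a \<times> (nat \<Rightarrow> real). (snd p)(k := 0))"
    by (rule continuous_on_coordinatewise_then_product)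
  then show ?thesis unfolding unstore_def by (intro continuous_on_Pair continuous_on_fst continuous_on_id coord)
qed

lemma unstore_store: "snd (fst p) k = 0 \<Longrightarrow> unstore k (store k p) = p"
  by (cases p) (auto simp: unstore_def store_def fun_eq_iff)

lemma store_zero: "r k = 0 \<Longrightarrow> store k ((x, r), 0) = (x, r)"
  by (auto simp: store_def)

context
  fixes X :: "'a::metric_space set" and As :: "'a set list" and D
  assumes compact_X: "compact X" and As_subset: "\<And>A. A \<in> set As \<Longrightarrow> A \<subseteq> X"
    and aux: "aux_sets X As D"
begin

lemma aux_set_stage: "k < length As \<Longrightarrow> aux_set (I_iter X D k) (I_base X As D k) (D k)"
  using aux by (simp add: aux_sets_def)

text \<open>Because coordinates from \<open>k\<close> on vanish on stage \<open>k\<close>, storing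
  at position \<open>k\<close> overwrites nothing, and a positive entry there marks the new
  points.\<close>

lemma I_iter_support:
  "k \<le> length As \<Longrightarrow> p \<in> I_iter X D k \<Longrightarrow> fst p \<in> X \<and> (\<forall>j\<ge>k. snd p j = 0)"
proof (induction k arbitrary: p)
  case 0
  then show ?case by auto
next
  case (Suc k)
  then obtain a t where p: "p = store k (a, t)" "(a, t) \<in> I_step (I_iter X D k) (D k)" by auto
  then have "a \<in> I_iter X D k"
    using aux_setD(1)[OF aux_set_stage[of k]] Suc.prems by (auto simp: I_step_def)
  then have "fst a \<in> X" "\<forall>j\<ge>k. snd a j = 0" using Suc by auto
  then show ?case using p by (cases a) (auto simp: store_def)
qed

lemma unstore_store_stage:
  assumes "k < length As" "p \<in> I_iter X D k \<times> UNIV"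
  shows "unstore k (store k p) = p"
  using I_iter_support[of k "fst p"] assms by (intro unstore_store) auto

lemma store_stage_zero: "k < length As \<Longrightarrow> a \<in> I_iter X D k \<Longrightarrow> store k (a, 0) = a"
  using I_iter_support[of k a] by (cases a) (auto intro: store_zero)

lemma store_image_zero:
  assumes "k < length As" "A \<subseteq> I_iter X D k"
  shows "store k ` (A \<times> {0}) = A"
proof -
  have "store k ` (A \<times> {0}) = (\<lambda>a. store k (a, 0)) ` A" by auto
  also have "\<dots> = id ` A"
    using assms store_stage_zero by (intro image_cong) auto
  finally show ?thesis by simp
qed

lemma I_iter_Suc:
  assumes "k < length As"
  shows "I_iter X D (Suc k) = I_iter X D k \<union> store k ` D k"
  using store_image_zero[OF assms order_refl] by (simp add: I_step_def image_Un)

lemma I_iter_layer: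
  assumes "k < length As"
  shows "I_iter X D (Suc k) - I_iter X D k = store k ` D k"
proof -
  have "I_iter X D k \<inter> store k ` D k = {}"
  proof (intro equals0I)
    fix p assume "p \<in> I_iter X D k \<inter> store k ` D k"
    then obtain d where d: "d \<in> D k" "p = store k d" "p \<in> I_iter X D k" by auto
    then have "snd p k = 0" using I_iter_support[of k p] assms by simp
    moreover have "snd p k > 0"
      using d aux_setD(1)[OF aux_set_stage[OF assms]] by (cases d) (auto simp: store_def)
    ultimately show False by simp
  qed
  then show ?thesis using I_iter_Suc[OF assms] by blast
qed

lemma closure_aux_subset:
  assumes "k < length As" "closed (I_iter X D k)"
  shows "closure (D k) \<subseteq> I_iter X D k \<times> {0..1}"
  using aux_setD(1)[OF aux_set_stage[OF assms(1)]] assms(2)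
  by (intro closure_minimal closed_Times) auto

lemma I_base_subset:
  assumes "k < length As" "closed (I_iter X D k)"
  shows "I_base X As D k \<subseteq> I_iter X D k"
proof -
  have "I_base X As D k \<times> {0} \<subseteq> closure (D k)"
    using aux_setD(4)[OF aux_set_stage[OF assms(1)]] by blast
  then show ?thesis using closure_aux_subset[OF assms] by fastforce
qed

lemma compact_stage: "k \<le> length As \<Longrightarrow> compact (I_iter X D k)"
proof (induction k)
  case 0
  then show ?case using compact_X by (simp add: compact_Times)
next
  case (Suc k)
  then have k: "k < length As" and comp: "compact (I_iter X D k)" by auto
  let ?Z = "I_iter X D k"
  have cl: "closed ?Z" using comp by (rule compact_imp_closed)
  have "closure (D k) - D k \<subseteq> ?Z \<times> {0}"
    unfolding aux_setD(4)[OF aux_set_stage[OF k]] using I_base_subset[OF k cl] by (rule Sigma_mono) simp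
  \<comment> \<open>The set \<open>D k\<close> is not closed in general, but the limit points it
    lacks lie at height 0 and are already present.\<close>
  then have "?Z \<times> {0} \<union> D k = ?Z \<times> {0} \<union> closure (D k)"
    using closure_subset[of "D k"] by blast
  moreover have "compact (closure (D k))"
    using closed_Int_compact[OF closed_closure compact_Times[OF comp compact_Icc], of "D k" 0 1]
      closure_aux_subset[OF k cl] by (simp add: Int_absorb2)
  ultimately have "compact (?Z \<times> {0} \<union> D k)" using comp by (simp add: compact_Un compact_Times)
  then have "compact (store k ` (?Z \<times> {0} \<union> D k))"
    by (intro compact_continuous_image continuous_store)
  then show ?case by (simp add: I_step_def)
qed

text \<open>The closure of \<open>D k\<close> is compact and \<open>store k\<close> is continuous
  and injective on it, so storing commutes with closure and with the removal of \<open>D k\<close>.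
  On the limit points, all at height 0, it is the identification with stage
  \<open>k\<close>.\<close>

lemma closure_layer_stage:
  assumes k: "k < length As"
  shows "closure (store k ` D k) - store k ` D k = I_base X As D k"
proof -
  let ?Z = "I_iter X D k"
  have comp: "compact ?Z" using k by (simp add: compact_stage)
  then have cl: "closed ?Z" by (rule compact_imp_closed)
  note sub = closure_aux_subset[OF k cl]
  have "compact (closure (D k))"
    using closed_Int_compact[OF closed_closure compact_Times[OF comp compact_Icc], of "D k" 0 1]
      sub by (simp add: Int_absorb2)
  then have "compact (store k ` closure (D k))"
    by (intro compact_continuous_image continuous_store)
  then have "closure (store k ` D k) \<subseteq> store k ` closure (D k)"
    by (intro closure_minimal compact_imp_closed image_mono closure_subset)
  moreover have "store k ` closure (D k) \<subseteq> closure (store k ` D k)"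
    by (intro image_closure_subset continuous_store closed_closure closure_subset)
  ultimately have "closure (store k ` D k) = store k ` closure (D k)" by blast
  moreover have "inj_on (store k) (closure (D k))"
    using sub unstore_store_stage[OF k] by (intro inj_on_inverseI[of _ "unstore k"]) auto
  then have "store k ` (closure (D k) - D k) = store k ` closure (D k) - store k ` D k"
    by (rule inj_on_image_set_diff) (auto simp: closure_subset)
  moreover have "store k ` (closure (D k) - D k) = I_base X As D k"
    using aux_setD(4)[OF aux_set_stage[OF k]] store_image_zero[OF k I_base_subset[OF k cl]] by simp
  ultimately show ?thesis by simp
qed

lemma discrete_layer_stage:
  assumes k: "k < length As"
  shows "discrete (store k ` D k)"
  unfolding discrete_def
proof
  fix p assume "p \<in> store k ` D k"
  then obtain d where d: "d \<in> D k" "p = store k d" by blast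
  have inv: "unstore k (store k e) = e" if "e \<in> D k" for e
    using aux_setD(1)[OF aux_set_stage[OF k]] that by (intro unstore_store_stage[OF k]) auto
  have "d isolated_in D k" using discreteD[OF aux_setD(3)[OF aux_set_stage[OF k]] d(1)] .
  then obtain U where U: "open U" "U \<inter> D k = {d}" by (rule isolated_inE)
  have "open (unstore k -` U)"
    by (rule open_vimage[OF U(1) continuous_unstore])
  moreover have "unstore k -` U \<inter> store k ` D k = {p}"
  proof (intro equalityI subsetI)
    fix x assume "x \<in> unstore k -` U \<inter> store k ` D k"
    then obtain e where "e \<in> D k" "x = store k e" "unstore k x \<in> U" by blast
    then have "e \<in> U \<inter> D k" using inv by simp
    then show "x \<in> {p}" using U(2) d(2) \<open>x = store k e\<close> by simp
  next
    fix x assume "x \<in> {p}"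
    moreover have "d \<in> U" using U(2) by blast
    ultimately show "x \<in> unstore k -` U \<inter> store k ` D k" using d inv[OF d(1)] by simp
  qed
  ultimately show "p isolated_in store k ` D k"
    using d by (intro isolated_inI) auto
qed

lemma tower_I_iter: "tower (I_iter X D) (\<lambda>k. As ! k \<times> {\<lambda>_. 0}) (length As)"
proof
  fix k assume k: "k < length As"
  show "I_iter X D k \<subseteq> I_iter X D (Suc k)" using I_iter_Suc[OF k] by blast
  show "As ! k \<times> {\<lambda>_. 0} \<subseteq> I_iter X D 0" using As_subset[of "As ! k"] k by auto
  show "discrete (I_iter X D (Suc k) - I_iter X D k)"
    unfolding I_iter_layer[OF k] by (rule discrete_layer_stage[OF k])
  show "I_iter X D (Suc k) - I_iter X D k \<noteq> {}"
    unfolding I_iter_layer[OF k] using aux_setD(2)[OF aux_set_stage[OF k]] by simp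
  show "closure (I_iter X D (Suc k) - I_iter X D k) - (I_iter X D (Suc k) - I_iter X D k) =
      (if k = 0 then {} else closure (I_iter X D k - I_iter X D (k - 1))) \<union> As ! k \<times> {\<lambda>_. 0}"
    unfolding I_iter_layer[OF k] closure_layer_stage[OF k] by (simp add: I_base_def)
  show "is_singleton (I_iter X D (Suc k) - I_iter X D k)"
    if "closure (I_iter X D (Suc k) - I_iter X D k) - (I_iter X D (Suc k) - I_iter X D k) = {}"
  proof -
    have "is_singleton (D k)"
      using that aux_setD(5)[OF aux_set_stage[OF k]]
      unfolding I_iter_layer[OF k] closure_layer_stage[OF k] by simp
    then show ?thesis unfolding I_iter_layer[OF k] by (auto simp: is_singleton_def)
  qed
qed (rule compact_stage)

end

section \<open>Boolean coding\<close>

lemma coding_subset: "(\<And>S. S \<in> set Ss \<Longrightarrow> S \<subseteq> X) \<Longrightarrow> A \<in> set (coding Ss) \<Longrightarrow> A \<subseteq> X"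
proof (induction Ss arbitrary: A rule: rev_induct)
  case Nil
  then show ?case by (simp add: coding_def)
next
  case (snoc S Ss)
  have "B \<subseteq> X" if "B \<in> set (coding Ss)" for B using snoc that by simp
  then show ?case using snoc.prems by (auto simp: coding_snoc coding_step_def)
qed

lemma sorted_coding: "sorted_wrt (\<subseteq>) (coding Ss)"
proof (induction Ss rule: rev_induct)
  case Nil
  then show ?case by (simp add: coding_def)
next
  case (snoc S Ss)
  have "sorted_wrt (\<lambda>A B. A \<inter> S \<subseteq> B \<inter> S) (coding Ss)" "sorted_wrt (\<lambda>A B. A \<union> S \<subseteq> B \<union> S) (coding Ss)"
    by (rule sorted_wrt_mono_rel[OF _ snoc]; blast)+
  then show ?case by (auto simp: coding_snoc coding_step_def sorted_wrt_append sorted_wrt_map)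
qed

lemma coding_image:
  assumes f: "inj_on f X"
  shows "(\<And>S. S \<in> set Ss \<Longrightarrow> S \<subseteq> X) \<Longrightarrow> coding (map ((`) f) Ss) = map ((`) f) (coding Ss)"
proof (induction Ss rule: rev_induct)
  case Nil
  then show ?case by (simp add: coding_def)
next
  case (snoc S Ss)
  have "f ` (B \<inter> S) = f ` B \<inter> f ` S" if "B \<in> set (coding Ss)" for B
    using coding_subset[of Ss X B] snoc.prems that by (intro inj_on_image_Int[OF f]) auto
  then show ?case using snoc by (simp add: coding_snoc coding_step_def image_Un)
qed

text \<open>The length of the code determines the number of sets, the middle entry is the last set
  \<open>S\<close>, and each \<open>B\<close> of the shorter code is determined by the pair
  \<open>B \<inter> S\<close> and \<open>B \<union> S\<close>.\<close>

lemma coding_inject: "coding Ss = coding Ts \<Longrightarrow> Ss = Ts"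
proof (induction Ss arbitrary: Ts rule: rev_induct)
  case Nil
  have "Suc (length (coding Ts)) = 2 ^ length Ts" by (simp add: length_coding)
  moreover have "coding Ts = []" using Nil by (simp add: coding_def)
  ultimately have "2 ^ length Ts = (2::nat) ^ 0" by simp
  then show ?case by (simp only: power_inject_exp) simp
next
  case (snoc S Ss)
  have pow: "Suc (length (coding Us)) = 2 ^ length Us" for Us :: "'a set list"
    by (simp add: length_coding)
  have "(2::nat) ^ length (Ss @ [S]) = 2 ^ length Ts"
    using pow[of "Ss @ [S]"] pow[of Ts] snoc.prems by simp
  then have "length (Ss @ [S]) = length Ts" by (rule power_inject_exp[THEN iffD1, rotated]) simp
  then have len: "length Ts = Suc (length Ss)" by simp
  then obtain Us T where Ts: "Ts = Us @ [T]" by (cases Ts rule: rev_cases) auto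
  then have "length (coding Ss) = length (coding Us)" using len by (simp add: length_coding)
  then have "map (\<lambda>B. B \<inter> S) (coding Ss) = map (\<lambda>B. B \<inter> T) (coding Us) \<and> S = T \<and>
      map (\<lambda>B. B \<union> S) (coding Ss) = map (\<lambda>B. B \<union> T) (coding Us)"
    using snoc.prems by (auto simp add: Ts coding_snoc coding_step_def)
  then have eq: "map (\<lambda>B. B \<inter> S) (coding Ss) = map (\<lambda>B. B \<inter> T) (coding Us)" "S = T"
      "map (\<lambda>B. B \<union> S) (coding Ss) = map (\<lambda>B. B \<union> T) (coding Us)"
    by blast+
  have "coding Ss = coding Us"
  proof (rule nth_equalityI)
    show "length (coding Ss) = length (coding Us)" by fact
    fix i assume i: "i < length (coding Ss)"
    then have "coding Ss ! i \<inter> S = coding Us ! i \<inter> S" "coding Ss ! i \<union> S = coding Us ! i \<union> S"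
      using arg_cong[OF eq(1), of "\<lambda>xs. xs ! i"] arg_cong[OF eq(3), of "\<lambda>xs. xs ! i"]
        \<open>length (coding Ss) = length (coding Us)\<close> eq(2) by simp_all
    then show "coding Ss ! i = coding Us ! i" by blast
  qed
  then show ?case using snoc.IH Ts eq(2) by blast
qed

section \<open>Recovering the sequence\<close>

text \<open>Base and rim are defined from the topology alone, so a homeomorphism of the fans
  preserves both; \<open>f\<close> is its restriction, read through the two embeddings at height
  0.\<close>

lemma fan_recover:
  assumes F: "fan_continuum Z B T q P X" and F': "fan_continuum Z' B' T' q' P' X'"
    and hom: "T homeomorphic_space T'"
  shows "\<exists>f g. homeomorphism (Z - P) (Z' - P') f g \<and> f ` (B - P) = B' - P'"
proof -
  interpret F: fan_continuum Z B T q P X by fact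
  interpret F': fan_continuum Z' B' T' q' P' X' by fact
  obtain h where h: "homeomorphic_map T T' h" using hom by (auto simp: homeomorphic_space)
  let ?i = "\<lambda>z. q (z, 0)" and ?i' = "\<lambda>z. q' (z, 0)"
  have i: "homeomorphic_map (top_of_set (Z - P)) (subtopology T (fan_base T)) ?i"
    unfolding F.fan_base_eq by (rule F.homeomorphic_map_q_base[OF F.closed_Z_Diff_P]) blast
  have i': "homeomorphic_map (top_of_set (Z' - P')) (subtopology T' (fan_base T')) ?i'"
    unfolding F'.fan_base_eq by (rule F'.homeomorphic_map_q_base[OF F'.closed_Z_Diff_P]) blast
  have sub: "fan_base T \<subseteq> topspace T" "fan_base T' \<subseteq> topspace T'"
    using F.B_subset F'.B_subset
    by (auto simp: F.fan_base_eq F'.fan_base_eq F.topspace_eq F'.topspace_eq)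
  have "homeomorphic_map (subtopology T (fan_base T)) (subtopology T' (fan_base T')) h"
    using homeomorphic_map_fan_base[OF h] sub
    by (intro homeomorphic_map_subtopologies[OF h]) (simp add: Int_absorb1)
  with i have hi: "homeomorphic_map (top_of_set (Z - P)) (subtopology T' (fan_base T')) (h \<circ> ?i)"
    by (rule homeomorphic_map_compose)
  obtain j where j: "homeomorphic_maps (top_of_set (Z' - P')) (subtopology T' (fan_base T')) ?i' j"
    using i' unfolding homeomorphic_map_maps by blast
  then have ji: "homeomorphic_map (subtopology T' (fan_base T')) (top_of_set (Z' - P')) j"
      "\<And>y. y \<in> Z' - P' \<Longrightarrow> j (?i' y) = y"
    unfolding homeomorphic_maps_map by auto
  define f where "f = j \<circ> (h \<circ> ?i)"
  have "homeomorphic_map (top_of_set (Z - P)) (top_of_set (Z' - P')) f"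
    unfolding f_def by (rule homeomorphic_map_compose[OF hi ji(1)])
  then obtain g where "homeomorphic_maps (top_of_set (Z - P)) (top_of_set (Z' - P')) f g"
    unfolding homeomorphic_map_maps by blast
  then have fg: "homeomorphism (Z - P) (Z' - P') f g" by (rule homeomorphic_maps_imp_homeomorphism)
  have im: "q ` (C \<times> {0}) = ?i ` C" "q' ` (C' \<times> {0}) = ?i' ` C'" for C C' by auto
  have "h ` ?i ` (B - P) = ?i' ` (B' - P')"
    using homeomorphic_map_fan_rim[OF h] unfolding F.fan_rim_eq F'.fan_rim_eq im .
  then have "f ` (B - P) = j ` ?i' ` (B' - P')"
    by (simp only: f_def image_comp[symmetric])
  also have "\<dots> = id ` (B' - P')"
    unfolding image_image using ji(2) F'.B_subset by (intro image_cong) auto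
  finally show ?thesis using fg by auto
qed

section \<open>Fans over the top stage of a tower\<close>

lemma (in tower) fan_isolated_top:
  assumes "n = Suc m"
  defines "B \<equiv> closure (Z n - Z 0)"
  shows "fan_isolated (Z n) B (fan (Z n) B) (\<lambda>a. fan_rel (Z n) B `` {a}) (layer m)"
proof -
  have m: "m < n" using assms by simp
  have B: "B = closure (layer m)" unfolding B_def assms(1) by (rule closure_stage_Diff_bottom[OF m])
  have BZ: "B \<subseteq> Z n" unfolding B assms(1) by (rule closure_layer_subset[OF m])
  have "compact B"
    using closed_Int_compact[OF closed_closure[of "layer m"] compact_stage[of n]] BZ
    unfolding B by (simp add: Int_absorb2)
  interpret fan_quotient "Z n" B "fan (Z n) B" "\<lambda>a. fan_rel (Z n) B `` {a}"
    by (rule fan_quotient_fan[OF compact_stage[OF order_refl] \<open>compact B\<close> BZ])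
  show ?thesis
    using isolated_layer[OF m] layer_ne[OF m] by unfold_locales (auto simp: B assms(1))
qed

lemma (in tower) fan_continuum_top:
  assumes "n = Suc m" "\<And>x. connected (Z 0 - {x})" "infinite (Z 0)"
  defines "B \<equiv> closure (Z n - Z 0)"
  shows "fan_continuum (Z n) B (fan (Z n) B) (\<lambda>a. fan_rel (Z n) B `` {a}) (layer m) (Z 0)"
proof -
  have m: "m < n" using assms by simp
  have B: "B = closure (layer m)" unfolding B_def assms(1) by (rule closure_stage_Diff_bottom[OF m])
  interpret fan_isolated "Z n" B "fan (Z n) B" "\<lambda>a. fan_rel (Z n) B `` {a}" "layer m"
    using fan_isolated_top[OF assms(1)] unfolding B_def .
  show ?thesis
  proof
    show "Z n = Z 0 \<union> B"
      using stage_Diff_bottom[OF m] B_subset stage_mono[of 0 n] unfolding B assms(1) by auto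
    show "Z 0 \<inter> layer m = {}" using stage_mono[of 0 m] m by auto
  qed (use assms in auto)
qed

section \<open>Nondegenerate bases and their separation from one-point bases\<close>

lemma connected_Times_sing_Diff:
  assumes "connected X" "\<And>x. \<not> cut_point X x"
  shows "connected (X \<times> {c} - {p})"
proof -
  have "X \<times> {c} - {p} = (if snd p = c then (X - {fst p}) \<times> {c} else X \<times> {c})" by (cases p) auto
  moreover have "connected (X - {fst p})"
    using assms unfolding cut_point_def by (cases "fst p \<in> X") auto
  ultimately show ?thesis using assms(1) by (simp add: connected_Times)
qed

lemma connected_uncountable_not_isolated:
  fixes S :: "'a::metric_space set"
  assumes "connected S" "uncountable S"
  shows "\<not> x isolated_in S"
proof -
  have "S \<noteq> {a}" for a using assms(2) by auto
  then show ?thesis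
    using connected_imp_perfect[OF assms(1), of x] by (auto simp: isolated_in_islimpt_iff)
qed

lemma countable_Times_sing: "countable (X \<times> {c}) \<longleftrightarrow> countable X"
proof -
  have "X \<times> {c} = (\<lambda>x. (x, c)) ` X" by auto
  then show ?thesis by (simp add: countable_image_inj_eq inj_on_def)
qed

lemma not_homeomorphic_fan_singleton:
  assumes T: "tower Z A n" "n = Suc m" and T': "tower Z' A' n'" "n' = Suc m'"
    and Z: "countable (Z 0)" and Z': "\<And>x. connected (Z' 0 - {x})" "uncountable (Z' 0)"
  shows "\<not> fan (Z n) (closure (Z n - Z 0)) homeomorphic_space fan (Z' n') (closure (Z' n' - Z' 0))"
    (is "\<not> ?T homeomorphic_space ?T'")
proof
  assume "?T homeomorphic_space ?T'"
  then obtain h where h: "homeomorphic_map ?T ?T' h" by (auto simp: homeomorphic_space)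
  interpret t: tower Z A n by fact
  interpret t': tower Z' A' n' by fact
  let ?q = "\<lambda>a. fan_rel (Z n) (closure (Z n - Z 0)) `` {a}"
  let ?q' = "\<lambda>a. fan_rel (Z' n') (closure (Z' n' - Z' 0)) `` {a}"
  interpret F: fan_isolated "Z n" "closure (Z n - Z 0)" ?T ?q "t.layer m"
    by (rule t.fan_isolated_top[OF T(2)])
  have "infinite (Z' 0)" using Z'(2) by (rule uncountable_infinite)
  with Z' interpret F': fan_continuum "Z' n'" "closure (Z' n' - Z' 0)" ?T' ?q' "t'.layer m'" "Z' 0"
    by (intro t'.fan_continuum_top[OF T'(2)])
  have "countable (Z n)" using t.countable_stage[OF Z] by simp
  then have "countable (?q ` (Z n \<times> {0}) \<union> ?q ` (closure (Z n - Z 0) \<times> {1}))"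
    using countable_subset[OF F.B_subset] by (intro countable_Un countable_image countable_SIGMA) auto
  then have "countable (fan_base ?T)" by (rule countable_subset[OF F.fan_base_subset])
  then have "countable (fan_base ?T')"
    using homeomorphic_map_fan_base[OF h] by (metis countable_image)
  moreover have "(\<lambda>z. ?q' (z, 0)) ` Z' 0 \<subseteq> fan_base ?T'"
    unfolding F'.fan_base_eq using F'.Z_eq F'.X_P by blast
  ultimately have "countable ((\<lambda>z. ?q' (z, 0)) ` Z' 0)" by (rule countable_subset[rotated])
  moreover have "inj_on (\<lambda>z. ?q' (z, 0)) (Z' 0)"
    using F'.q_base_inj F'.Z_eq by (auto intro: inj_on_subset)
  ultimately show False using Z'(2) countable_image_inj_on by blast
qed

text \<open>Two one-point bases are set apart because the equivalence fails there. With three sets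
  there are seven layers; if the coded sets become nonempty at a position from 3 to 7, the result is
  always a countable compact space with one point of top Cantor-Bendixson rank 6, equal to the
  closure of the added points. Such spaces are all homeomorphic, although the sequences
  differ.\<close>

theorem theorem4p3:
  fixes X :: "'a::metric_space set" and Y :: "'b::metric_space set"
    and S :: "'a set list" and T :: "'b set list"
    and D :: "nat \<Rightarrow> (('a \<times> (nat \<Rightarrow> real)) \<times> real) set"
    and E :: "nat \<Rightarrow> (('b \<times> (nat \<Rightarrow> real)) \<times> real) set"
  assumes "continuum X" and "continuum Y"
    and "\<And>x. \<not> cut_point X x" and "\<And>y. \<not> cut_point Y y"
    and "\<not> (is_singleton X \<and> is_singleton Y)"
    and "S \<noteq> []" and "T \<noteq> []"
    and "\<And>A. A \<in> set S \<Longrightarrow> closedin (top_of_set X) A"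
    and "\<And>B. B \<in> set T \<Longrightarrow> closedin (top_of_set Y) B"
    and "J_choice X S D" and "J_choice Y T E"
  shows "(\<exists>f g. homeomorphism X Y f g \<and> length S = length T \<and>
            (\<forall>i < length S. f ` (S ! i) = T ! i))
         \<longleftrightarrow> J_space X S D homeomorphic_space J_space Y T E"
proof -
  let ?c = "\<lambda>_::nat. 0::real"
  let ?Z = "I_iter X D" and ?A = "\<lambda>k. coding S ! k \<times> {?c}" and ?n = "length (coding S)"
  let ?Z' = "I_iter Y E" and ?A' = "\<lambda>k. coding T ! k \<times> {?c}" and ?n' = "length (coding T)"
  have X: "compact X" "connected X" and Y: "compact Y" "connected Y"
    using assms(1,2) by (auto simp: continuum_def)
  have SX: "\<And>A. A \<in> set S \<Longrightarrow> A \<subseteq> X" and TY: "\<And>B. B \<in> set T \<Longrightarrow> B \<subseteq> Y"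
    using closedin_subset[OF assms(8)] closedin_subset[OF assms(9)] by auto
  note cX = coding_subset[of S X, OF SX] and cY = coding_subset[of T Y, OF TY]
  have tower: "tower ?Z ?A ?n" and tower': "tower ?Z' ?A' ?n'"
    using assms(10,11) cX cY X(1) Y(1) by (auto intro!: tower_I_iter simp: J_choice_def)
  interpret t: tower ?Z ?A ?n by fact
  interpret t': tower ?Z' ?A' ?n' by fact
  \<comment> \<open>Guarantees that a last layer, and with it a leg, exists.\<close>
  have pos: "length (coding Us) \<noteq> 0" if "Us \<noteq> []" for Us :: "'c set list"
  proof
    assume "length (coding Us) = 0"
    then have "coding Us = coding []" by (simp add: coding_def)
    then show False using coding_inject that by blast
  qed
  obtain m m' where m: "?n = Suc m" and m': "?n' = Suc m'"
    using pos[OF assms(6)] pos[OF assms(7)] by (metis not0_implies_Suc)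
  define B where "B = closure (?Z ?n - ?Z 0)"
  define B' where "B' = closure (?Z' ?n' - ?Z' 0)"
  have J: "J_space X S D = fan (?Z ?n) B" "J_space Y T E = fan (?Z' ?n') B'"
    by (simp_all add: J_space_def I_space_def B_def B'_def)
  have aux: "aux_sets X (coding S) D" "aux_sets Y (coding T) E"
    using assms(10,11) by (simp_all only: J_choice_def)
  have lt: "0 < ?n" "0 < ?n'" using m m' by simp_all
  \<comment> \<open>The bottom layer is nonempty and sits over points of the base, so the bases are
    nonempty.\<close>
  obtain p p' where "p \<in> ?Z (Suc 0)" "p' \<in> ?Z' (Suc 0)"
    using t.layer_ne[OF lt(1)] t'.layer_ne[OF lt(2)] by blast
  then have ne: "X \<noteq> {}" "Y \<noteq> {}"
    using I_iter_support[OF X(1) cX aux(1) Suc_leI[OF lt(1)]]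
      I_iter_support[OF Y(1) cY aux(2) Suc_leI[OF lt(2)]] by blast+
  have BZ: "B \<subseteq> ?Z ?n"
    unfolding B_def m using t.closed_stage[of "Suc m"] m by (intro closure_minimal) auto
  have "compact B"
    using closed_Int_compact[OF closed_closure[of "?Z ?n - ?Z 0"] t.compact_stage[OF order_refl]] BZ
    unfolding B_def by (simp add: Int_absorb2)
  show ?thesis
  proof
    assume "\<exists>f g. homeomorphism X Y f g \<and> length S = length T \<and> (\<forall>i < length S. f ` (S ! i) = T ! i)"
    then obtain f g where fg: "homeomorphism X Y f g" "length S = length T"
        "\<And>i. i < length S \<Longrightarrow> f ` (S ! i) = T ! i"
      by blast
    have "T = map ((`) f) S" using fg(2,3) by (intro nth_equalityI) auto
    then have T: "coding T = map ((`) f) (coding S)"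
      using coding_image[OF homeomorphism_imp_inj_on[OF fg(1)], of S] SX by simp
    have hom0: "homeomorphism (?Z 0) (?Z' 0) (\<lambda>p. (f (fst p), snd p)) (\<lambda>p. (g (fst p), snd p))"
    proof (rule homeomorphismI)
      have "continuous_on X f" "continuous_on Y g" using fg(1) by (simp_all add: homeomorphism_def)
      then show "continuous_on (?Z 0) (\<lambda>p. (f (fst p), snd p))" "continuous_on (?Z' 0) (\<lambda>p. (g (fst p), snd p))"
        by (auto intro!: continuous_on_Pair continuous_on_snd continuous_on_id
            intro: continuous_on_compose2 continuous_on_fst)
    qed (use fg(1) in \<open>auto simp: homeomorphism_def\<close>)
    have A: "(\<lambda>p. (f (fst p), snd p)) ` ?A k = ?A' k" if "k < ?n" for k
      using that by (auto simp: T image_iff)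
    have n: "?n' = ?n" by (simp add: T)
    obtain F G where FG: "homeomorphism (?Z ?n) (?Z' ?n) F G" "\<And>j. j \<le> ?n \<Longrightarrow> F ` ?Z j = ?Z' j"
      using tower_extend[OF tower tower'[unfolded n] hom0 A order_refl] by blast
    have "F ` (?Z ?n - ?Z 0) = ?Z' ?n - ?Z' 0"
      using inj_on_image_set_diff[OF homeomorphism_imp_inj_on[OF FG(1)], of "?Z ?n" "?Z 0"]
        FG(2)[of 0] FG(2)[of ?n] t.stage_mono[of 0 ?n] by simp
    moreover have "F ` B = closure (F ` (?Z ?n - ?Z 0))"
      unfolding B_def by (rule homeomorphism_image_closure[OF FG(1) t.compact_stage]) auto
    ultimately have "F ` B = B'" by (simp only: B'_def n)
    then show "J_space X S D homeomorphic_space J_space Y T E"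
      unfolding J n by (rule fan_homeomorphic_space[OF t.compact_stage[OF order_refl] \<open>compact B\<close> BZ FG(1)])
  next
    assume hom: "J_space X S D homeomorphic_space J_space Y T E"
    have cut: "connected (?Z 0 - {p})" "connected (?Z' 0 - {p'})" for p p'
      unfolding I_iter.simps
      by (rule connected_Times_sing_Diff[OF X(2) assms(3)], rule connected_Times_sing_Diff[OF Y(2) assms(4)])
    have countable_iff: "countable (?Z 0) \<longleftrightarrow> countable X" "countable (?Z' 0) \<longleftrightarrow> countable Y"
      by (simp_all add: countable_Times_sing)
    \<comment> \<open>A connected metric space with at least two points is uncountable.\<close>
    have sing: "countable X \<longleftrightarrow> is_singleton X" "countable Y \<longleftrightarrow> is_singleton Y"
      using connected_card_eq_iff_nontrivial[OF X(2)] connected_card_eq_iff_nontrivial[OF Y(2)] ne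
      by (auto simp: is_singleton_def)
    have "\<not> is_singleton X"
    proof
      assume "is_singleton X"
      then show False
        using not_homeomorphic_fan_singleton[OF tower m tower' m'] cut hom assms(5) countable_iff sing
        unfolding J B_def B'_def by blast
    qed
    moreover have "\<not> is_singleton Y"
    proof
      assume "is_singleton Y"
      then show False
        using not_homeomorphic_fan_singleton[OF tower' m' tower m] cut hom[THEN homeomorphic_space_sym[THEN iffD1]]
          assms(5) countable_iff sing
        unfolding J B_def B'_def by blast
    qed
    ultimately have unc: "uncountable (?Z 0)" "uncountable (?Z' 0)"
      using countable_iff sing by auto
    have fans: "fan_continuum (?Z ?n) B (fan (?Z ?n) B) (\<lambda>a. fan_rel (?Z ?n) B `` {a}) (t.layer m) (?Z 0)"
      "fan_continuum (?Z' ?n') B' (fan (?Z' ?n') B') (\<lambda>a. fan_rel (?Z' ?n') B' `` {a}) (t'.layer m') (?Z' 0)"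
      unfolding B_def B'_def
      using t.fan_continuum_top[OF m cut(1) uncountable_infinite[OF unc(1)]]
        t'.fan_continuum_top[OF m' cut(2) uncountable_infinite[OF unc(2)]] by auto
    obtain f g where fg: "homeomorphism (?Z ?n - t.layer m) (?Z' ?n' - t'.layer m') f g"
        "f ` (B - t.layer m) = B' - t'.layer m'"
      using fan_recover[OF fans hom[unfolded J]] by blast
    have "?Z ?n - t.layer m = ?Z m" "?Z' ?n' - t'.layer m' = ?Z' m'"
      using t.stage_Suc[of m] t'.stage_Suc[of m'] m m' by auto
    with fg(1) have hom_m: "homeomorphism (?Z m) (?Z' m') f g" by simp
    have "B - t.layer m = t.layer_base m" "B' - t'.layer m' = t'.layer_base m'"
      using t.closure_stage_Diff_bottom[of m] t'.closure_stage_Diff_bottom[of m'] m m'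
      by (simp_all add: B_def B'_def t.layer_base_def t'.layer_base_def)
    with fg(2) have lim: "f ` t.layer_base m = t'.layer_base m'" by simp
    have "connected (?Z 0)" "connected (?Z' 0)"
      using X(2) Y(2) by (simp_all add: connected_Times)
    then have perfect: "\<not> p isolated_in ?Z 0" "\<not> p' isolated_in ?Z' 0" for p p'
      using unc connected_uncountable_not_isolated by blast+
    have incr: "?A k \<subseteq> ?A (Suc k)" if "k < m" for k
      using sorted_wrt_nth_less[OF sorted_coding, of k "Suc k" S] that m by auto
    have incr': "?A' k \<subseteq> ?A' (Suc k)" if "k < m'" for k
      using sorted_wrt_nth_less[OF sorted_coding, of k "Suc k" T] that m' by auto
    have rec: "m = m'" "f ` ?Z 0 = ?Z' 0" "\<And>k. k \<le> m \<Longrightarrow> f ` ?A k = ?A' k"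
      using tower_recover[OF tower[unfolded m] tower'[unfolded m'] perfect incr incr' hom_m lim] by auto
    \<comment> \<open>The bottom stage is \<open>X\<close> times the zero function, so dropping the
      constant second component turns \<open>f\<close> into a map of \<open>X\<close>.\<close>
    define \<phi> where "\<phi> x = fst (f (x, ?c))" for x
    define \<psi> where "\<psi> y = fst (g (y, ?c))" for y
    have hom0: "homeomorphism (?Z 0) (?Z' 0) f g"
      using t.stage_mono[of 0 m] t'.stage_mono[of 0 m'] m m' rec(2)
      by (intro homeomorphism_of_subsets[OF hom_m]) auto
    have "fst (f (x, ?c)) \<in> Y \<and> f (x, ?c) = (\<phi> x, ?c)" if "x \<in> X" for x
    proof -
      have "f (x, ?c) \<in> ?Z' 0" unfolding rec(2)[symmetric] using that by auto
      then show ?thesis by (cases "f (x, ?c)") (auto simp: \<phi>_def)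
    qed
    then have f: "f (x, ?c) = (\<phi> x, ?c)" "\<phi> x \<in> Y" if "x \<in> X" for x
      using that by (auto simp: \<phi>_def)
    have "fst (g (y, ?c)) \<in> X \<and> g (y, ?c) = (\<psi> y, ?c)" if "y \<in> Y" for y
    proof -
      have "g ` ?Z' 0 = ?Z 0" using hom0 by (simp only: homeomorphism_def)
      then have "g (y, ?c) \<in> ?Z 0" using that by auto
      then show ?thesis by (cases "g (y, ?c)") (auto simp: \<psi>_def)
    qed
    then have g: "g (y, ?c) = (\<psi> y, ?c)" "\<psi> y \<in> X" if "y \<in> Y" for y
      using that by (auto simp: \<psi>_def)
    have hom_XY: "homeomorphism X Y \<phi> \<psi>"
    proof (rule homeomorphismI)
      have "continuous_on (?Z 0) f" "continuous_on (?Z' 0) g" using hom0 by (simp_all add: homeomorphism_def)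
      then have "continuous_on X (\<lambda>x. f (x, ?c))" "continuous_on Y (\<lambda>y. g (y, ?c))"
        by (auto intro!: continuous_on_Pair continuous_on_id continuous_on_const
            elim!: continuous_on_compose2)
      then show "continuous_on X \<phi>" "continuous_on Y \<psi>"
        unfolding \<phi>_def \<psi>_def by (simp_all only: continuous_on_fst)
      show "\<phi> ` X \<subseteq> Y" "\<psi> ` Y \<subseteq> X" using f g by auto
      show "\<psi> (\<phi> x) = x" if "x \<in> X" for x
        using homeomorphism_apply1[OF hom0, of "(x, ?c)"] f g(1) that by simp
      show "\<phi> (\<psi> y) = y" if "y \<in> Y" for y
        using homeomorphism_apply2[OF hom0, of "(y, ?c)"] g f(1) that by simp
    qed
    have "\<phi> ` (coding S ! k) = coding T ! k" if "k < ?n" for k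
    proof -
      have "coding S ! k \<subseteq> X" using that by (intro cX nth_mem)
      then have "f ` ?A k = (\<lambda>x. (\<phi> x, ?c)) ` (coding S ! k)"
        using f by (force simp: image_iff)
      then have "(\<lambda>x. (\<phi> x, ?c)) ` (coding S ! k) = ?A' k" using rec(3)[of k] that m by simp
      then have "fst ` (\<lambda>x. (\<phi> x, ?c)) ` (coding S ! k) = fst ` ?A' k" by (rule arg_cong)
      then show ?thesis by (simp add: image_image)
    qed
    moreover have "?n = ?n'" using m m' rec(1) by simp
    ultimately have "map ((`) \<phi>) (coding S) = coding T" by (intro nth_equalityI) auto
    then have "coding (map ((`) \<phi>) S) = coding T"
      using coding_image[OF homeomorphism_imp_inj_on[OF hom_XY], of S] SX by simp
    then have "T = map ((`) \<phi>) S" by (rule coding_inject[symmetric])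
    then show "\<exists>f g. homeomorphism X Y f g \<and> length S = length T \<and> (\<forall>i < length S. f ` (S ! i) = T ! i)"
      using hom_XY by auto
  qed
qed

end
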